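(* Fix $0<q<1$. For each $n\ge 1$ let $L_n=L_n(q)$ denote the length of a longest increasing subsequence of a random $\mathrm{Mallows}(q)$ permutation of $[n]$. Then there exist constants $\sigma=\sigma(q)>0$ and $a=a(q)>0$ such that $$\frac{L_n-an}{\sigma\sqrt n}\Rightarrow \mathcal N(0,1)\qquad\text{as } n\to\infty,$$ where $\Rightarrow$ denotes convergence in distribution and $\mathcal N(0,1)$ is the standard normal distribution.
   Context: $[n]=\{1,\dots,n\}$ and $\mathcal S_n$ is the set of permutations of $[n]$. For $\pi\in\mathcal S_n$, $\mathrm{inv}(\pi)=\#\{(i,j):1\le i<j\le n,\ \pi(i)>\pi(j)\}$. A random permutation $\Pi$ of $[n]$ is $\mathrm{Mallows}(q)$ ($q>0$) if $\mathbb P(\Pi=\pi)=q^{\mathrm{inv}(\pi)}/Z_{n,q}$ for every $\pi\in\mathcal S_n$, where $Z_{n,q}=\sum_{\pi\in\mathcal S_n}q^{\mathrm{inv}(\pi)}$. An increasing subsequence of $\pi$ of length $k$ is a sequence $1\le i_1<\dots<i_k\le n$ with $\pi(i_1)<\dots<\pi(i_k)$; a longest increasing subsequence is one of maximum length. *)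

theory Defs
  imports "HOL-Probability.Probability" "HOL-Combinatorics.Permutations"
begin

definition inv_count :: "nat \<Rightarrow> (nat \<Rightarrow> nat) \<Rightarrow> nat" where
  "inv_count n \<pi> = card {(i, j). 1 \<le> i \<and> i < j \<and> j \<le> n \<and> \<pi> i > \<pi> j}"

definition mallows_Z :: "nat \<Rightarrow> real \<Rightarrow> real" where
  "mallows_Z n q = (\<Sum>\<pi> | \<pi> permutes {1..n}. q ^ inv_count n \<pi>)"

text \<open>
  Permutations of \<open>{1..n}\<close> are functions on \<open>nat\<close> that are the identity outside \<open>{1..n}\<close>.
  The probability mass function below is only meaningful for \<open>q > 0\<close>; see \<open>pmf_mallows\<close>.
\<close>

definition mallows :: "nat \<Rightarrow> real \<Rightarrow> (nat \<Rightarrow> nat) pmf" where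
  "mallows n q =
     embed_pmf (\<lambda>\<pi>. if \<pi> permutes {1..n} then q ^ inv_count n \<pi> / mallows_Z n q else 0)"

definition increasing_subseq :: "nat \<Rightarrow> (nat \<Rightarrow> nat) \<Rightarrow> nat list \<Rightarrow> bool" where
  "increasing_subseq n \<pi> is \<longleftrightarrow>
     set is \<subseteq> {1..n} \<and> sorted_wrt (<) is \<and> sorted_wrt (<) (map \<pi> is)"

definition lis_length :: "nat \<Rightarrow> (nat \<Rightarrow> nat) \<Rightarrow> nat" where
  "lis_length n \<pi> = Max {length is | is. increasing_subseq n \<pi> is}"

lemma mallows_Z_pos:
  assumes "q > 0"
  shows "mallows_Z n q > 0"
  unfolding mallows_Z_def
proof (rule sum_pos)
  show "finite {\<pi>. \<pi> permutes {1..n}}"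
    by (simp add: finite_permutations)
  have "id permutes {1..n}"
    by (rule permutes_id)
  then show "{\<pi>. \<pi> permutes {1..n}} \<noteq> {}"
    by blast
qed (use assms in simp)

lemma pmf_mallows:
  assumes "q > 0"
  shows "pmf (mallows n q) \<pi> =
    (if \<pi> permutes {1..n} then q ^ inv_count n \<pi> / mallows_Z n q else 0)"
  unfolding mallows_def
proof (rule pmf_embed_pmf)
  let ?P = "{\<pi>. \<pi> permutes {1..n}}"
  let ?f = "\<lambda>\<pi>. if \<pi> permutes {1..n} then q ^ inv_count n \<pi> / mallows_Z n q else 0"
  have Z: "mallows_Z n q > 0"
    using assms by (rule mallows_Z_pos)
  show nonneg: "0 \<le> ?f \<pi>" for \<pi>
    using assms Z by simp
  have fin: "finite ?P"
    by (simp add: finite_permutations)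
  have "(\<integral>\<^sup>+\<pi>. ennreal (?f \<pi>) \<partial>count_space UNIV) = (\<Sum>\<pi>\<in>?P. ennreal (?f \<pi>))"
    by (rule nn_integral_count_space') (use fin in auto)
  also have "\<dots> = ennreal (\<Sum>\<pi>\<in>?P. ?f \<pi>)"
    by (rule sum_ennreal) (rule nonneg)
  also have "(\<Sum>\<pi>\<in>?P. ?f \<pi>) = (\<Sum>\<pi>\<in>?P. q ^ inv_count n \<pi> / mallows_Z n q)"
    by (rule sum.cong) auto
  also have "\<dots> = (\<Sum>\<pi>\<in>?P. q ^ inv_count n \<pi>) / mallows_Z n q"
    by (rule sum_divide_distrib[symmetric])
  also have "\<dots> = 1"
    using Z by (simp add: mallows_Z_def)
  finally show "(\<integral>\<^sup>+\<pi>. ennreal (?f \<pi>) \<partial>count_space UNIV) = 1"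
    by simp
qed

lemma finite_increasing_subseq: "finite {is. increasing_subseq n \<pi> is}"
proof (rule finite_subset)
  show "{is. increasing_subseq n \<pi> is} \<subseteq> {is. set is \<subseteq> {1..n} \<and> distinct is}"
    by (auto simp: increasing_subseq_def strict_sorted_iff)
  show "finite {is. set is \<subseteq> {1..n} \<and> distinct is}"
    by (rule finite_subset_distinct) simp
qed

lemma increasing_subseq_Nil: "increasing_subseq n \<pi> []"
  by (simp add: increasing_subseq_def)

end

theory Submission
  imports
    Defs
    "HOL-Library.Sublist"
    "HOL-Combinatorics.Multiset_Permutations"
    "HOL-Real_Asymp.Real_Asymp"
begin

text \<open>
  Cut a permutation of \<open>{1..n}\<close> at every \<open>k\<close> for which \<open>{1..k}\<close> is invariant. Inversions and longest increasing
  subsequences are additive over the resulting indecomposable blocks, so if an indecomposable block \<open>\<beta>\<close> has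
  weight \<open>w \<beta> = (1 - q) ^ length \<beta> * q ^ inv \<beta>\<close>, then the partition functions \<open>u\<^sub>n = (1 - q) ^ n * Z\<^sub>n\<close> form the
  renewal sequence of the block lengths. Explicitly \<open>u\<^sub>n = (1 - q) \<cdots> (1 - q ^ n)\<close>, which converges
  geometrically to some \<open>\<phi> > 0\<close>, and this forces block lengths to have geometric tails.

  Let \<open>V = L - a * length\<close> be the block score, with \<open>a\<close> chosen so that \<open>V\<close> has mean zero, and let
  \<open>b\<^sub>n(t) = u\<^sub>n * E (exp (i t (L\<^sub>n - a n)))\<close>. Comparing the renewal equations of \<open>b(t)\<close> and of \<open>u = b(0)\<close> gives
  \<open>b\<^sub>n(t) = u\<^sub>n + \<phi> D(t) (b\<^sub>0(t) + \<dots> + b\<^sub>n(t)) + O(t)\<close>, where \<open>D(t) = - t\<^sup>2 v / 2 + O(t\<^sup>3)\<close> is the total weight of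
  \<open>exp (i t V) - 1\<close> and \<open>v\<close> is the total weight of \<open>V\<^sup>2\<close>. Solving this linear recursion at \<open>t = s / sqrt n\<close>
  yields \<open>b\<^sub>n(t) \<longlonglongrightarrow> \<phi> exp (- \<phi> v s\<^sup>2 / 2)\<close>, and the theorem follows from the continuity theorem of Levy.
\<close>

subsection \<open>Inversions and increasing subsequences of lists\<close>

text \<open>Permutations are treated in one-line notation as lists, because cutting into blocks is
  then concatenation up to a shift of the entries, and both statistics are unchanged by
  order-preserving relabelling.\<close>

fun list_inv :: "'a::linorder list \<Rightarrow> nat" where
  "list_inv [] = 0"
| "list_inv (x # xs) = length (filter (\<lambda>y. y < x) xs) + list_inv xs"

definition list_lis :: "'a::linorder list \<Rightarrow> nat" where
  "list_lis xs = Max (length ` {ys. subseq ys xs \<and> sorted_wrt (<) ys})"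

lemma list_inv_append:
  assumes "\<And>x y. x \<in> set xs \<Longrightarrow> y \<in> set ys \<Longrightarrow> x < y"
  shows "list_inv (xs @ ys) = list_inv xs + list_inv ys"
  using assms
proof (induction xs)
  case (Cons x xs)
  have "filter (\<lambda>y. y < x) ys = []"
    using Cons.prems by (force simp: filter_empty_conv)
  with Cons show ?case by auto
qed simp

lemma list_inv_map:
  assumes "strict_mono f"
  shows "list_inv (map f xs) = list_inv xs"
  by (induction xs) (auto simp: filter_map o_def strict_mono_less[OF assms])

lemma list_inv_snoc:
  "list_inv (xs @ [x]) = list_inv xs + length (filter (\<lambda>y. x < y) xs)"
  by (induction xs) auto

lemma finite_subseq: "finite {ys. subseq ys xs \<and> P ys}"
proof (rule finite_subset)
  show "{ys. subseq ys xs \<and> P ys} \<subseteq> {ys. subseq ys xs}" by auto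
  show "finite {ys. subseq ys xs}" by (subst set_subseqs_eq[symmetric]) (rule finite_set)
qed

lemma list_lis_le:
  assumes "\<And>ys. subseq ys xs \<Longrightarrow> sorted_wrt (<) ys \<Longrightarrow> length ys \<le> k"
  shows "list_lis xs \<le> k"
  unfolding list_lis_def
  by (subst Max_le_iff) (use assms in \<open>auto simp: finite_subseq intro!: exI[of _ "[]"]\<close>)

lemma le_list_lis:
  assumes "subseq ys xs" "sorted_wrt (<) ys"
  shows "length ys \<le> list_lis xs"
  unfolding list_lis_def by (rule Max_ge) (use assms in \<open>auto simp: finite_subseq\<close>)

lemma list_lis_witness:
  obtains ys where "subseq ys xs" "sorted_wrt (<) ys" "length ys = list_lis xs"
proof -
  have "list_lis xs \<in> length ` {ys. subseq ys xs \<and> sorted_wrt (<) ys}"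
    unfolding list_lis_def by (rule Max_in) (auto simp: finite_subseq intro!: exI[of _ "[]"])
  then show ?thesis using that by auto
qed

lemma list_lis_le_length: "list_lis xs \<le> length xs"
  by (rule list_lis_le) (metis not_subseq_length not_le)

text \<open>An increasing subsequence of the concatenation splits at the cut into two increasing
  pieces. Conversely, optimal pieces from both sides can be glued, since all entries on the left lie
  below those on the right.\<close>

lemma list_lis_append:
  assumes "\<And>x y. x \<in> set xs \<Longrightarrow> y \<in> set ys \<Longrightarrow> x < y"
  shows "list_lis (xs @ ys) = list_lis xs + list_lis ys"
proof (rule antisym)
  show "list_lis (xs @ ys) \<le> list_lis xs + list_lis ys"
  proof (rule list_lis_le)
    fix zs assume "subseq zs (xs @ ys)" and s: "sorted_wrt (<) zs"
    then obtain us vs where "zs = us @ vs" "subseq us xs" "subseq vs ys"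
      by (auto elim: subseq_appendE)
    with s show "length zs \<le> list_lis xs + list_lis ys"
      using le_list_lis[of us xs] le_list_lis[of vs ys] by (auto simp: sorted_wrt_append)
  qed
  obtain us where us: "subseq us xs" "sorted_wrt (<) us" "length us = list_lis xs"
    by (rule list_lis_witness)
  obtain vs where vs: "subseq vs ys" "sorted_wrt (<) vs" "length vs = list_lis ys"
    by (rule list_lis_witness)
  have "set us \<subseteq> set xs" "set vs \<subseteq> set ys"
    using us vs by (auto simp: subseq_conv_nths dest!: in_set_nthsD)
  then have "sorted_wrt (<) (us @ vs)"
    using us vs assms by (auto simp: sorted_wrt_append)
  moreover have "subseq (us @ vs) (xs @ ys)"
    using us vs by (intro list_emb_append_mono)
  ultimately show "list_lis xs + list_lis ys \<le> list_lis (xs @ ys)"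
    using le_list_lis[of "us @ vs" "xs @ ys"] us vs by simp
qed

lemma subseq_map_iff: "subseq ys (map f xs) \<longleftrightarrow> (\<exists>zs. subseq zs xs \<and> ys = map f zs)"
  by (auto simp: subseq_conv_nths nths_map)

lemma list_lis_map:
  assumes "strict_mono f"
  shows "list_lis (map f xs) = list_lis xs"
proof -
  have "{ys. subseq ys (map f xs) \<and> sorted_wrt (<) ys} = map f ` {ys. subseq ys xs \<and> sorted_wrt (<) ys}"
    by (auto simp: subseq_map_iff sorted_wrt_map strict_mono_less[OF assms])
  then show ?thesis by (simp add: list_lis_def image_image)
qed

subsection \<open>Permutations as lists\<close>

lemma inv_count_eq_list_inv: "inv_count n \<pi> = list_inv (map \<pi> [1..<Suc n])"
proof (induction n)
  case 0
  have "{(i, j). 1 \<le> i \<and> i < j \<and> j \<le> 0 \<and> \<pi> i > \<pi> j} = {}" by auto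
  then show ?case unfolding inv_count_def by (simp only: card.empty) simp
next
  case (Suc n)
  let ?A = "{(i, j). 1 \<le> i \<and> i < j \<and> j \<le> n \<and> \<pi> i > \<pi> j}"
  let ?B = "{i \<in> {1..n}. \<pi> i > \<pi> (Suc n)}"
  have fin: "finite ?A"
    by (rule finite_subset[of _ "{..n} \<times> {..n}"]) auto
  have "{(i, j). 1 \<le> i \<and> i < j \<and> j \<le> Suc n \<and> \<pi> i > \<pi> j} = ?A \<union> (\<lambda>i. (i, Suc n)) ` ?B"
    by (auto simp: le_Suc_eq)
  then have "inv_count (Suc n) \<pi> = card ?A + card ((\<lambda>i. (i, Suc n)) ` ?B)"
    unfolding inv_count_def
  proof (simp only:, intro card_Un_disjoint[OF fin])
    show "finite ((\<lambda>i. (i, Suc n)) ` ?B)" by simp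
    show "?A \<inter> (\<lambda>i. (i, Suc n)) ` ?B = {}" by auto
  qed
  also have "card ((\<lambda>i. (i, Suc n)) ` ?B) = card ?B"
    by (rule card_image) (auto simp: inj_on_def)
  also have "\<dots> = length (filter (\<lambda>y. \<pi> (Suc n) < y) (map \<pi> [1..<Suc n]))"
    by (subst distinct_length_filter[symmetric] | simp add: filter_map o_def distinct_length_filter)+
      (auto intro!: arg_cong[of _ _ card])
  finally show ?case
    using Suc by (simp add: inv_count_def list_inv_snoc)
qed

lemma lis_length_eq_list_lis: "lis_length n \<pi> = list_lis (map \<pi> [1..<Suc n])"
proof -
  have sub: "subseq is [1..<Suc n] \<longleftrightarrow> set is \<subseteq> {1..n} \<and> sorted_wrt (<) is" for "is"
  proof
    assume *: "subseq is [1..<Suc n]"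
    then obtain N where N: "is = nths [1..<Suc n] N" by (auto simp: subseq_conv_nths)
    have "sorted_wrt (<) is" unfolding N strict_sorted_iff 
      by (metis distinct_nthsI distinct_upt sorted_nths sorted_upt)
    moreover have "set is \<subseteq> {1..n}"
      using set_nths_subset[of "[1..<Suc n]" N] unfolding N by auto
    ultimately show "set is \<subseteq> {1..n} \<and> sorted_wrt (<) is" by simp
  next
    assume "set is \<subseteq> {1..n} \<and> sorted_wrt (<) is"
    then show "subseq is [1..<Suc n]"
      by (intro sorted_subset_imp_subseq) (auto simp del: upt_Suc)
  qed
  have "{ys. subseq ys (map \<pi> [1..<Suc n]) \<and> sorted_wrt (<) ys} = map \<pi> ` {is. increasing_subseq n \<pi> is}"
    unfolding subseq_map_iff sub increasing_subseq_def by (auto simp: sorted_wrt_map)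
  then have "length ` {ys. subseq ys (map \<pi> [1..<Suc n]) \<and> sorted_wrt (<) ys} = {length is | is. increasing_subseq n \<pi> is}"
    by (auto simp: image_image)
  then show ?thesis by (simp add: list_lis_def lis_length_def)
qed

lemma bij_betw_permutes_lists:
  "bij_betw (\<lambda>\<pi>. map \<pi> [1..<Suc n]) {\<pi>. \<pi> permutes {1..n}} (permutations_of_set {1..n})"
proof (rule bij_betw_imageI)
  have eq: "\<pi> = \<rho>" if "\<pi> permutes {1..n}" "\<rho> permutes {1..n}" 
    "map \<pi> [1..<Suc n] = map \<rho> [1..<Suc n]" for \<pi> \<rho> :: "nat \<Rightarrow> nat"
  proof
    fix x
    show "\<pi> x = \<rho> x"
    proof (cases "x \<in> {1..n}")
      case True
      then show ?thesis using that(3) by (auto simp del: upt_Suc)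
    next
      case False
      then show ?thesis using that(1,2) by (metis permutes_not_in)
    qed
  qed
  then show inj: "inj_on (\<lambda>\<pi>. map \<pi> [1..<Suc n]) {\<pi>. \<pi> permutes {1..n}}"
    by (auto intro!: inj_onI)
  have sub: "(\<lambda>\<pi>. map \<pi> [1..<Suc n]) ` {\<pi>. \<pi> permutes {1..n}} \<subseteq> permutations_of_set {1..n}"
  proof (intro image_subsetI permutations_of_setI)
    fix \<pi> assume "\<pi> \<in> {\<pi>. \<pi> permutes {1..n}}"
    then have p: "\<pi> permutes {1..n}" by simp
    have "set [1..<Suc n] = {1..n}" by auto
    then show "set (map \<pi> [1..<Suc n]) = {1..n}"
      using permutes_image[OF p] by (metis set_map)
    show "distinct (map \<pi> [1..<Suc n])"
      using permutes_inj_on[OF p] by (simp add: distinct_map del: upt_Suc)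
  qed
  show "(\<lambda>\<pi>. map \<pi> [1..<Suc n]) ` {\<pi>. \<pi> permutes {1..n}} = permutations_of_set {1..n}"
  \<comment> \<open>Surjectivity is obtained by counting: both finite sets have
    \<open>fact n\<close> elements.\<close>
  proof (rule card_subset_eq)
    have "card {\<pi>. \<pi> permutes {1..n}} = fact n"
      by (rule card_permutations) simp_all
    then show "card ((\<lambda>\<pi>. map \<pi> [1..<Suc n]) ` {\<pi>. \<pi> permutes {1..n}}) = card (permutations_of_set {1..n})"
      by (simp only: card_image[OF inj]) simp
  qed (use sub in simp_all)
qed

text \<open>The first entry contributes its rank in \<open>A\<close>, which runs through 0, ...,
  \<open>card A - 1\<close>, while the rest is an arbitrary arrangement of the remaining elements;
  the result is the q-factorial. Allowing a general set \<open>A\<close> makes the induction free of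
  relabelling.\<close>

lemma sum_permutations_list_inv:
  fixes q :: "'a::comm_ring_1" and A :: "nat set"
  assumes "finite A"
  shows "(\<Sum>xs\<in>permutations_of_set A. q ^ list_inv xs) = (\<Prod>i=1..card A. \<Sum>j<i. q ^ j)"
  using assms
proof (induction "card A" arbitrary: A)
  case 0
  then show ?case by simp
next
  case (Suc n)
  let ?S = "\<lambda>A. \<Sum>xs\<in>permutations_of_set A. q ^ list_inv xs"
  let ?r = "\<lambda>x. card {y\<in>A. y < x}"
  have ne: "A \<noteq> {}" using Suc.hyps by auto
  have "?S A = (\<Sum>x\<in>A. \<Sum>xs\<in>(#) x ` permutations_of_set (A - {x}). q ^ list_inv xs)"
    by (subst permutations_of_set_nonempty[OF ne], rule sum.UNION_disjoint) (use Suc.prems in auto)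
  also have "\<dots> = (\<Sum>x\<in>A. q ^ ?r x * ?S (A - {x}))"
  proof (rule sum.cong)
    fix x assume x: "x \<in> A"
    have "(\<Sum>xs\<in>(#) x ` permutations_of_set (A - {x}). q ^ list_inv xs)
        = (\<Sum>xs\<in>permutations_of_set (A - {x}). q ^ list_inv (x # xs))"
      by (subst sum.reindex) auto
    also have "\<dots> = (\<Sum>xs\<in>permutations_of_set (A - {x}). q ^ ?r x * q ^ list_inv xs)"
    proof (rule sum.cong)
      fix xs assume "xs \<in> permutations_of_set (A - {x})"
      from permutations_of_setD[OF this] have "length (filter (\<lambda>y. y < x) xs) = ?r x"
        by (subst distinct_length_filter) (auto intro!: arg_cong[of _ _ card])
      then show "q ^ list_inv (x # xs) = q ^ ?r x * q ^ list_inv xs" by (simp add: power_add)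
    qed simp
    finally show "(\<Sum>xs\<in>(#) x ` permutations_of_set (A - {x}). q ^ list_inv xs) = q ^ ?r x * ?S (A - {x})"
      by (simp add: sum_distrib_left)
  qed simp
  also have "\<dots> = (\<Sum>x\<in>A. q ^ ?r x * (\<Prod>i=1..n. \<Sum>j<i. q ^ j))"
  proof (rule sum.cong)
    fix x assume "x \<in> A"
    then have "n = card (A - {x})" using Suc.hyps(2) Suc.prems by simp
    with Suc.hyps(1)[OF this] Suc.prems
    show "q ^ ?r x * ?S (A - {x}) = q ^ ?r x * (\<Prod>i=1..n. \<Sum>j<i. q ^ j)" by simp
  qed simp
  also have "\<dots> = (\<Sum>x\<in>A. q ^ ?r x) * (\<Prod>i=1..n. \<Sum>j<i. q ^ j)"
    by (simp add: sum_distrib_right)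
  also have "(\<Sum>x\<in>A. q ^ ?r x) = (\<Sum>j<Suc n. q ^ j)"
  proof -
    have less: "?r x < ?r y" if "x \<in> A" "x < y" for x y
      by (rule psubset_card_mono) (use that Suc.prems in auto)
    have inj: "inj_on ?r A"
      by (rule linorder_inj_onI) (use less in fastforce)+
    have "?r ` A \<subseteq> {..<Suc n}"
      unfolding Suc.hyps(2) by (auto intro!: psubset_card_mono Suc.prems)
    then have "?r ` A = {..<Suc n}"
      by (rule card_subset_eq[rotated]) (use card_image[OF inj] Suc.hyps(2) in simp_all)
    then show ?thesis
      using sum.reindex[OF inj, of "\<lambda>j. q ^ j"] by (simp add: o_def)
  qed
  also have "\<dots> * (\<Prod>i=1..n. \<Sum>j<i. q ^ j) = (\<Prod>i=1..card A. \<Sum>j<i. q ^ j)"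
    by (simp add: Suc.hyps(2)[symmetric] prod.nat_ivl_Suc' mult.commute)
  finally show ?case .
qed

subsection \<open>Decomposition into indecomposable blocks\<close>

text \<open>The empty list is excluded, so a first block always has positive length and the renewal
  convolution starts at \<open>m = 1\<close>.\<close>

definition indecomposables :: "nat \<Rightarrow> nat list set" where
  "indecomposables n = {xs \<in> permutations_of_set {1..n}. 0 < n \<and> (\<forall>k\<in>{0<..<n}. set (take k xs) \<noteq> {1..k})}"

lemma finite_indecomposables: "finite (indecomposables n)"
  by (rule finite_subset[of _ "permutations_of_set {1..n}"]) (auto simp: indecomposables_def)

definition direct_sum :: "nat list \<Rightarrow> nat list \<Rightarrow> nat list" where
  "direct_sum xs ys = xs @ map ((+) (length xs)) ys"

text \<open>A nonempty permutation has exactly one first indecomposable block: it ends at the first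
  positive position whose prefix is itself a permutation of an initial segment.\<close>

lemma bij_betw_direct_sum:
  assumes "0 < n"
  shows "bij_betw (\<lambda>(m, xs, ys). direct_sum xs ys)
    (SIGMA m:{1..n}. indecomposables m \<times> permutations_of_set {1..n - m})
    (permutations_of_set {1..n})"
proof (rule bij_betw_imageI)
  let ?D = "SIGMA m:{1..n}. indecomposables m \<times> permutations_of_set {1..n - m}"
  have len: "length xs = m" if "xs \<in> indecomposables m" for xs m
    using that by (auto simp: indecomposables_def dest: length_finite_permutations_of_set)
  \<comment> \<open>If \<open>xs'\<close> were longer than \<open>xs\<close>, then \<open>xs\<close>
    would be an invariant proper prefix of \<open>xs'\<close>, against indecomposability.\<close>
  have le: "m' \<le> m" if "xs \<in> indecomposables m" "xs' \<in> indecomposables m'" 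
    "direct_sum xs ys = direct_sum xs' ys'" for m m' xs ys xs' ys'
  proof (rule ccontr)
    assume "\<not> m' \<le> m"
    moreover from this have "take m xs' = xs"
      using arg_cong[OF that(3), of "take m"] len[OF that(1)] len[OF that(2)]
      by (simp add: direct_sum_def)
    moreover have "set xs = {1..m}" "0 < m"
      using that by (auto simp: indecomposables_def dest: permutations_of_setD)
    ultimately show False
      using that(2) by (auto simp: indecomposables_def)
  qed
  show "inj_on (\<lambda>(m, xs, ys). direct_sum xs ys) ?D"
  proof (rule inj_onI)
    fix z z'
    assume z: "z \<in> ?D" "z' \<in> ?D"
      "(\<lambda>(m, xs, ys). direct_sum xs ys) z = (\<lambda>(m, xs, ys). direct_sum xs ys) z'"
    obtain m xs ys m' xs' ys' where z_eq: "z = (m, xs, ys)" "z' = (m', xs', ys')"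
      by (metis prod_cases3)
    with z have *: "xs \<in> indecomposables m" "xs' \<in> indecomposables m'"
      "direct_sum xs ys = direct_sum xs' ys'" by auto
    have m: "m = m'" using le[OF *] le[OF *(2,1) *(3)[symmetric]] by simp
    with * len have "length xs = length xs'" by metis
    then have "xs = xs'" "map ((+) (length xs)) ys = map ((+) (length xs)) ys'"
      using *(3) by (auto simp: direct_sum_def)
    moreover from this(2) have "ys = ys'" by (rule map_injective) simp
    ultimately show "z = z'" using m z_eq by simp
  qed
  show "(\<lambda>(m, xs, ys). direct_sum xs ys) ` ?D = permutations_of_set {1..n}"
  proof (intro equalityI subsetI)
    fix zs assume "zs \<in> (\<lambda>(m, xs, ys). direct_sum xs ys) ` ?D"
    then obtain m xs ys where z: "m \<in> {1..n}" "xs \<in> indecomposables m" 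
      "ys \<in> permutations_of_set {1..n - m}" "zs = direct_sum xs ys" by auto
    have xs: "set xs = {1..m}" "distinct xs" using z by (auto simp: indecomposables_def dest: permutations_of_setD)
    have ys: "set ys = {1..n - m}" "distinct ys" using z by (auto dest: permutations_of_setD)
    have "(+) m ` {1..n - m} = {m + 1..n}"
      using z(1) by (simp add: image_add_atLeastAtMost)
    then show "zs \<in> permutations_of_set {1..n}"
      using z xs ys len[OF z(2)]
      by (intro permutations_of_setI) (auto simp: direct_sum_def distinct_map)
  next
    fix zs assume zs: "zs \<in> permutations_of_set {1..n}"
    \<comment> \<open>The minimum exists because \<open>k = n\<close> qualifies; minimality makes
      the prefix indecomposable.\<close>
    define m where "m = (LEAST k. 0 < k \<and> set (take k zs) = {1..k})"
    have lz: "length zs = n" using length_finite_permutations_of_set[OF zs] by simp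
    have dz: "distinct zs" "set zs = {1..n}" using permutations_of_setD[OF zs] by auto
    have n: "0 < n \<and> set (take n zs) = {1..n}"
      using assms dz lz by simp
    have m: "0 < m \<and> set (take m zs) = {1..m}" unfolding m_def
      by (rule LeastI[where P = "\<lambda>k. 0 < k \<and> set (take k zs) = {1..k}", OF n])
    have mn: "m \<le> n" unfolding m_def
      by (rule Least_le[where P = "\<lambda>k. 0 < k \<and> set (take k zs) = {1..k}", OF n])
    have least: "set (take k zs) \<noteq> {1..k}" if "0 < k" "k < m" for k
      using not_less_Least[of k "\<lambda>k. 0 < k \<and> set (take k zs) = {1..k}"] that unfolding m_def by auto
    let ?ys = "map (\<lambda>x. x - m) (drop m zs)"
    have ind: "take m zs \<in> indecomposables m"
      using m least dz by (auto simp: indecomposables_def distinct_take min_def)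
    have "set (drop m zs) = {1..n} - {1..m}"
      using dz m set_take_disj_set_drop_if_distinct[of zs m m] 
      by (metis (no_types, lifting) Diff_disjoint Diff_triv Un_Diff append_take_drop_id inf_commute order_refl set_append Un_Diff_cancel2 sup_bot.left_neutral Diff_cancel)
    also have "\<dots> = {m + 1..n}" by auto
    finally have sd: "set (drop m zs) = {m + 1..n}" .
    have "?ys \<in> permutations_of_set {1..n - m}"
    proof (rule permutations_of_setI)
      have "(\<lambda>x. x - m) ` {m + 1..n} = {1..n - m}"
        using mn by (auto simp: image_iff intro!: bexI[of _ "_ + m"])
      then show "set ?ys = {1..n - m}" by (simp add: sd)
      show "distinct ?ys"
        using dz sd by (auto simp: distinct_map inj_on_def)
    qed
    moreover have "direct_sum (take m zs) ?ys = zs"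
    proof -
      have "map ((+) m) ?ys = drop m zs"
        using sd by (auto intro!: map_idI simp: o_def)
      then show ?thesis using lz mn by (simp add: direct_sum_def)
    qed
    ultimately show "zs \<in> (\<lambda>(m, xs, ys). direct_sum xs ys) ` ?D"
      using m mn ind by (intro image_eqI[of _ _ "(m, take m zs, ?ys)"]) auto
  qed
qed

text \<open>Splitting off the first block turns a multiplicative weight into a renewal equation. The
  semiring is kept general because the lemma serves both the real weights and the complex weights of
  the characteristic function.\<close>

lemma sum_permutations_renewal:
  fixes W :: "nat list \<Rightarrow> 'a::comm_semiring_1"
  assumes W: "\<And>m k xs ys. xs \<in> permutations_of_set {1..m} \<Longrightarrow> ys \<in> permutations_of_set {1..k} \<Longrightarrow>
      W (direct_sum xs ys) = W xs * W ys"
    and "0 < n"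
  shows "(\<Sum>zs\<in>permutations_of_set {1..n}. W zs) =
    (\<Sum>m=1..n. (\<Sum>xs\<in>indecomposables m. W xs) * (\<Sum>ys\<in>permutations_of_set {1..n - m}. W ys))"
proof -
  have "(\<Sum>m=1..n. (\<Sum>xs\<in>indecomposables m. W xs) * (\<Sum>ys\<in>permutations_of_set {1..n - m}. W ys))
     = (\<Sum>m=1..n. \<Sum>(xs, ys)\<in>indecomposables m \<times> permutations_of_set {1..n - m}. W (direct_sum xs ys))"
    unfolding sum_product sum.cartesian_product
    by (intro sum.cong) (auto simp: indecomposables_def W)
  also have "\<dots> = (\<Sum>(m, xs, ys)\<in>(SIGMA m:{1..n}. indecomposables m \<times> permutations_of_set {1..n - m}). W (direct_sum xs ys))"
    by (subst sum.Sigma) (auto simp: finite_indecomposables)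
  also have "\<dots> = (\<Sum>zs\<in>permutations_of_set {1..n}. W zs)"
    using sum.reindex_bij_betw[OF bij_betw_direct_sum[OF assms(2)], of W] by (simp add: case_prod_beta)
  finally show ?thesis by simp
qed

lemma direct_sum_less:
  assumes "xs \<in> permutations_of_set {1..m}" "ys \<in> permutations_of_set {1..k}"
    "x \<in> set xs" "y \<in> set (map ((+) (length xs)) ys)"
  shows "x < y"
  using assms length_finite_permutations_of_set[OF assms(1)]
    permutations_of_setD(1)[OF assms(1)] permutations_of_setD(1)[OF assms(2)] by auto

lemma 
  assumes "xs \<in> permutations_of_set {1..m}" "ys \<in> permutations_of_set {1..k}"
  shows list_inv_direct_sum: "list_inv (direct_sum xs ys) = list_inv xs + list_inv ys"
    and list_lis_direct_sum: "list_lis (direct_sum xs ys) = list_lis xs + list_lis ys"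
proof -
  have sm: "strict_mono ((+) (length xs))" by (auto simp: strict_mono_def)
  note less = direct_sum_less[OF assms]
  show "list_inv (direct_sum xs ys) = list_inv xs + list_inv ys"
    unfolding direct_sum_def by (subst list_inv_append) (use less in \<open>auto simp: list_inv_map[OF sm]\<close>)
  show "list_lis (direct_sum xs ys) = list_lis xs + list_lis ys"
    unfolding direct_sum_def by (subst list_lis_append) (use less in \<open>auto simp: list_lis_map[OF sm]\<close>)
qed

subsection \<open>Renewal sequences\<close>

definition q_pochhammer :: "real \<Rightarrow> nat \<Rightarrow> real" where
  "q_pochhammer q n = (\<Prod>i=1..n. 1 - q ^ i)"

lemma q_pochhammer_0 [simp]: "q_pochhammer q 0 = 1"
  by (simp add: q_pochhammer_def)

lemma q_pochhammer_Suc: "q_pochhammer q (Suc n) = q_pochhammer q n * (1 - q ^ Suc n)"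
  by (simp add: q_pochhammer_def prod.nat_ivl_Suc' mult.commute)

lemma q_pochhammer_pos: "0 < q \<Longrightarrow> q < 1 \<Longrightarrow> 0 < q_pochhammer q n"
  unfolding q_pochhammer_def by (rule prod_pos) (auto intro: power_Suc_less_one power_less_one_iff simp: power_less_one_iff)

lemma q_pochhammer_le_1: "0 < q \<Longrightarrow> q < 1 \<Longrightarrow> q_pochhammer q n \<le> 1"
  unfolding q_pochhammer_def by (rule prod_le_1) (auto simp: power_le_one)

text \<open>The limit is positive because the infinite product converges absolutely and has no zero
  factor. The rate comes from enclosing the limit between a decreasing and an increasing
  sequence.\<close>

lemma q_pochhammer_limit:
  assumes q: "0 < q" "q < 1"
  obtains \<phi> where "0 < \<phi>" "\<phi> \<le> 1" "q_pochhammer q \<longlonglongrightarrow> \<phi>"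
    "\<And>n. \<bar>q_pochhammer q n - \<phi>\<bar> \<le> q ^ n / (1 - q)"
proof -
  let ?g = "\<lambda>i. 1 - q ^ Suc i"
  have "abs_convergent_prod ?g"
    using q by (intro summable_imp_abs_convergent_prod) (auto intro!: summable_mult summable_geometric)
  then have conv: "convergent_prod ?g" by (rule abs_convergent_prod_imp_convergent_prod)
  define \<phi> where "\<phi> = prodinf ?g"
  have "(\<lambda>n. \<Prod>i\<le>n. ?g i) \<longlonglongrightarrow> \<phi>"
    unfolding \<phi>_def by (rule convergent_prod_LIMSEQ[OF conv])
  moreover have "(\<Prod>i\<le>n. ?g i) = q_pochhammer q (Suc n)" for n
    by (induction n) (simp_all add: q_pochhammer_Suc)
  ultimately have lim: "q_pochhammer q \<longlonglongrightarrow> \<phi>"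
    by (subst filterlim_sequentially_Suc[symmetric]) simp
  have "\<phi> \<noteq> 0"
    unfolding \<phi>_def using q by (intro prodinf_nonzero[OF conv]) (metis power_Suc_less_one diff_gt_0_iff_gt less_irrefl)
  moreover have "0 \<le> \<phi>"
    by (rule LIMSEQ_le_const[OF lim]) (use q_pochhammer_pos[OF q] in \<open>auto intro: less_imp_le\<close>)
  ultimately have pos: "0 < \<phi>" by simp
  have le1: "\<phi> \<le> 1"
    by (rule LIMSEQ_le_const2[OF lim]) (use q_pochhammer_le_1[OF q] in auto)
  have upper: "\<phi> \<le> q_pochhammer q n" for n
  proof (rule decseq_ge[OF _ lim], rule decseq_SucI)
    show "q_pochhammer q (Suc n) \<le> q_pochhammer q n" for n
      using q_pochhammer_pos[OF q, of n] q by (simp add: q_pochhammer_Suc mult_left_le)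
  qed
  \<comment> \<open>The subtracted term is the geometric sum of \<open>q ^ Suc i\<close> over all
    \<open>i \<ge> n\<close>, which dominates all later decrements
    \<open>q ^ Suc i * q_pochhammer q i\<close>.\<close>
  have lower: "q_pochhammer q n - q ^ Suc n / (1 - q) \<le> \<phi>" for n
  proof (rule incseq_le[where X = "\<lambda>n. q_pochhammer q n - q ^ Suc n / (1 - q)"])
    show "incseq (\<lambda>n. q_pochhammer q n - q ^ Suc n / (1 - q))"
    proof (rule incseq_SucI)
      fix n
      have "0 \<le> q ^ Suc n * (1 - q_pochhammer q n)"
        using q q_pochhammer_le_1[OF q] by simp
      also have "\<dots> = q_pochhammer q (Suc n) - q ^ Suc (Suc n) / (1 - q) - (q_pochhammer q n - q ^ Suc n / (1 - q))"
      proof -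
        have "q ^ Suc n / (1 - q) - q ^ Suc (Suc n) / (1 - q) = q ^ Suc n * (1 - q) / (1 - q)"
          by (simp add: diff_divide_distrib algebra_simps)
        also have "\<dots> = q ^ Suc n" using q by simp
        finally show ?thesis by (simp add: q_pochhammer_Suc algebra_simps)
      qed
      finally show "q_pochhammer q n - q ^ Suc n / (1 - q) \<le> q_pochhammer q (Suc n) - q ^ Suc (Suc n) / (1 - q)"
        by simp
    qed
    have "(\<lambda>n. q ^ n) \<longlonglongrightarrow> 0" using q by (intro LIMSEQ_realpow_zero) auto
    then have "(\<lambda>n. q ^ Suc n) \<longlonglongrightarrow> 0" by (rule LIMSEQ_Suc)
    from tendsto_diff[OF lim tendsto_divide[OF this tendsto_const[of "1 - q"]]] q
    show "(\<lambda>n. q_pochhammer q n - q ^ Suc n / (1 - q)) \<longlonglongrightarrow> \<phi>" by simp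
  qed
  have "\<bar>q_pochhammer q n - \<phi>\<bar> \<le> q ^ n / (1 - q)" for n
  proof -
    have "q ^ Suc n / (1 - q) \<le> q ^ n / (1 - q)"
      using q by (intro divide_right_mono power_decreasing) auto
    then show ?thesis using upper[of n] lower[of n] by linarith
  qed
  with pos le1 lim that show ?thesis by blast
qed

text \<open>The coefficients telescope, since \<open>q ^ Suc j * q_pochhammer q j\<close> is the
  decrement from \<open>j\<close> to \<open>Suc j\<close>, so their total is 1 - \<phi> < 1. The
  power series still converges at \<open>1 / sqrt q > 1\<close>, and by continuity its value stays
  below 1 slightly to the right of 1.\<close>

lemma q_pochhammer_kernel_less_1:
  assumes q: "0 < q" "q < 1"
  obtains z where "1 < z" "\<And>n. (\<Sum>j<n. q ^ Suc j * q_pochhammer q j * z ^ Suc j) \<le> 1"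
proof -
  define c where "c n = q ^ Suc n * q_pochhammer q n" for n
  define R where "R = 1 / sqrt q"
  have R: "1 < R" using q unfolding R_def by simp
  have qR: "q * R = sqrt q" using q unfolding R_def by (simp add: real_div_sqrt)
  have c0: "0 \<le> c n" for n using q_pochhammer_pos[OF q, of n] q by (simp add: c_def)
  have cle: "c n \<le> q ^ n" for n
  proof -
    have "c n \<le> q ^ Suc n * 1" unfolding c_def using q q_pochhammer_le_1[OF q] by (intro mult_left_mono) auto
    also have "\<dots> \<le> q ^ n" using q by (simp add: mult_left_le_one_le)
    finally show ?thesis .
  qed
  have summ: "summable (\<lambda>n. c n * x ^ n)" if "0 \<le> x" "x \<le> R" for x
  proof (rule summable_comparison_test')
    show "summable (\<lambda>n. sqrt q ^ n)" using q by (intro summable_geometric) auto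
    show "norm (c n * x ^ n) \<le> sqrt q ^ n" if "n \<ge> 0" for n
    proof -
      have "c n * x ^ n \<le> q ^ n * R ^ n" using \<open>0 \<le> x\<close> \<open>x \<le> R\<close> q c0 cle by (intro mult_mono power_mono) auto
      then show ?thesis using c0[of n] \<open>0 \<le> x\<close> by (simp add: power_mult_distrib[symmetric] qR)
    qed
  qed
  obtain \<phi> where \<phi>: "0 < \<phi>" "q_pochhammer q \<longlonglongrightarrow> \<phi>"
    using q_pochhammer_limit[OF q] by metis
  have "(\<Sum>j<n. c j) = 1 - q_pochhammer q n" for n
    by (induction n) (simp_all add: c_def q_pochhammer_Suc algebra_simps)
  with tendsto_diff[OF tendsto_const[of 1] \<phi>(2)] have "c sums (1 - \<phi>)" by (simp add: sums_def)
  then have one: "(\<Sum>n. c n * 1 ^ n) = 1 - \<phi>" by (simp add: sums_iff)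
  have "isCont (\<lambda>x. \<Sum>n. c n * x ^ n) 1"
    by (rule isCont_powser[of _ R]) (use R in \<open>auto intro: summ\<close>)
  then have "isCont (\<lambda>x. x * (\<Sum>n. c n * x ^ n)) 1" by (intro continuous_intros)
  then have "((\<lambda>x. x * (\<Sum>n. c n * x ^ n)) \<longlongrightarrow> 1 - \<phi>) (at 1)" unfolding isCont_def one by simp
  then have "((\<lambda>x. x * (\<Sum>n. c n * x ^ n)) \<longlongrightarrow> 1 - \<phi>) (at_right 1)"
    by (rule tendsto_within_subset) auto
  then have "eventually (\<lambda>x. x * (\<Sum>n. c n * x ^ n) < 1) (at_right 1)"
    by (rule order_tendstoD) (use \<phi> in simp)
  moreover have "eventually (\<lambda>x. x \<in> {1<..<R}) (at_right 1)"
    by (rule eventually_at_right_real[OF R])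
  ultimately have "eventually (\<lambda>x. x * (\<Sum>n. c n * x ^ n) < 1 \<and> x \<in> {1<..<R}) (at_right 1)"
    by eventually_elim simp
  then obtain z where z: "z * (\<Sum>n. c n * z ^ n) < 1" "1 < z" "z < R"
    using eventually_happens' trivial_limit_at_right_real by fastforce
  show ?thesis
  proof (rule that[OF z(2)])
    fix n
    have "(\<Sum>j<n. q ^ Suc j * q_pochhammer q j * z ^ Suc j) = z * (\<Sum>j<n. c j * z ^ j)"
      by (simp add: c_def sum_distrib_left mult_ac)
    also have "\<dots> \<le> z * (\<Sum>j. c j * z ^ j)"
      using z c0 by (intro mult_left_mono sum_le_suminf summ) auto
    finally show "(\<Sum>j<n. q ^ Suc j * q_pochhammer q j * z ^ Suc j) \<le> 1" using z by simp
  qed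
qed

section \<open>Renewal equations as power series and geometric tails of the block sizes\<close>

lemma renewal_fps:
  fixes u f :: "nat \<Rightarrow> 'a::comm_ring_1"
  assumes "u 0 = 1" "f 0 = 0" "\<And>n. 0 < n \<Longrightarrow> u n = (\<Sum>m=1..n. f m * u (n - m))"
  shows "Abs_fps u * (1 - Abs_fps f) = 1"
proof -
  have "Abs_fps u = 1 + Abs_fps f * Abs_fps u"
  proof (rule fps_ext)
    fix n
    show "fps_nth (Abs_fps u) n = fps_nth (1 + Abs_fps f * Abs_fps u) n"
    proof (cases n)
      case 0
      then show ?thesis using assms by simp
    next
      case (Suc k)
      then show ?thesis using assms(2) assms(3)[of n]
        by (simp add: fps_mult_nth sum.atLeast_Suc_atMost)
    qed
  qed
  then show ?thesis by (simp add: algebra_simps)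
qed

text \<open>
  With \<open>U\<close> and \<open>F\<close> the generating functions of \<open>u\<close> and \<open>f\<close>, the tails \<open>T\<^sub>n = 1 - f\<^sub>1 - \<dots> - f\<^sub>n\<close>
  have generating function \<open>(1 - F) / (1 - X) = 1 / ((1 - X) U)\<close>, and \<open>(1 - X) U = 1 - (\<Sum>j. q ^ (j + 1) * u\<^sub>j * X ^ (j + 1))\<close>.
\<close>

lemma renewal_tail_recursion:
  fixes f :: "nat \<Rightarrow> real"
  assumes f0: "f 0 = 0"
    and ren: "\<And>n. 0 < n \<Longrightarrow> q_pochhammer q n = (\<Sum>m=1..n. f m * q_pochhammer q (n - m))"
  defines "T \<equiv> \<lambda>n. 1 - (\<Sum>m\<le>n. f m)"
  shows "T (Suc n) = (\<Sum>j\<le>n. q ^ Suc j * q_pochhammer q j * T (n - j))"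
proof -
  let ?U = "Abs_fps (q_pochhammer q)" and ?F = "Abs_fps f" and ?T = "Abs_fps T"
  let ?P = "(1 - fps_X) * ?U"
  have T: "(1 - fps_X) * ?T = 1 - ?F"
  proof (rule fps_ext)
    show "fps_nth ((1 - fps_X) * ?T) n = fps_nth (1 - ?F) n" for n
      by (cases n) (simp_all add: T_def f0 left_diff_distrib)
  qed
  have "?P * ?T = ?U * ((1 - fps_X) * ?T)" by (simp add: mult_ac)
  also have "\<dots> = 1" unfolding T by (rule renewal_fps) (use f0 ren in auto)
  finally have PT: "?P * ?T = 1" .
  have P0: "fps_nth ?P 0 = 1" by simp
  have PS: "fps_nth ?P (Suc j) = - (q ^ Suc j * q_pochhammer q j)" for j
    by (simp add: left_diff_distrib q_pochhammer_Suc algebra_simps)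
  have "0 = fps_nth (?P * ?T) (Suc n)" unfolding PT by simp
  also have "\<dots> = (\<Sum>i=0..Suc n. fps_nth ?P i * T (Suc n - i))"
    by (subst fps_mult_nth) simp
  also have "\<dots> = fps_nth ?P 0 * T (Suc n) + (\<Sum>j\<le>n. fps_nth ?P (Suc j) * T (n - j))"
    unfolding atLeast0AtMost by (subst sum.atMost_Suc_shift) simp
  also have "\<dots> = T (Suc n) - (\<Sum>j\<le>n. q ^ Suc j * q_pochhammer q j * T (n - j))"
    unfolding P0 PS by (simp add: sum_negf)
  finally show ?thesis by simp
qed

text \<open>Write \<open>r ^ m\<close> as the square of \<open>sqrt r ^ m\<close>: one factor
  absorbs the cube and the other remains as geometric decay.\<close>

lemma power3_geometric_bound:
  fixes r :: real
  assumes "0 < r" "r < 1"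
  obtains K \<rho> where "0 < \<rho>" "\<rho> < 1" "0 < K" "\<And>m. real m ^ 3 * r ^ m \<le> K * \<rho> ^ m"
proof -
  define s where "s = sqrt r"
  have s: "0 < s" "s < 1" "r = s * s" using assms unfolding s_def by auto
  have "(\<lambda>m. real m ^ 3 * s ^ m) \<longlonglongrightarrow> 0" using s(1,2) by real_asymp
  then have "Bseq (\<lambda>m. real m ^ 3 * s ^ m)" by (intro convergent_imp_Bseq convergentI)
  then obtain K where K: "0 < K" "\<And>m. norm (real m ^ 3 * s ^ m) \<le> K" by (auto elim: BseqE)
  have "real m ^ 3 * r ^ m \<le> K * s ^ m" for m
  proof -
    have "real m ^ 3 * r ^ m = (real m ^ 3 * s ^ m) * s ^ m" by (simp add: s(3) power_mult_distrib)
    also have "\<dots> \<le> K * s ^ m" using K(2)[of m] s by (intro mult_right_mono) auto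
    finally show ?thesis .
  qed
  with s K that show ?thesis by blast
qed

text \<open>The tails obey a recursion whose kernel has mass at most 1 even after tilting by some
  \<open>z > 1\<close>, so they decay like \<open>(1 / z) ^ n\<close>. The cube is what the Taylor
  remainder of the characteristic function will need, and \<open>q \<le> \<rho>\<close> lets the
  same rate control the convergence of \<open>q_pochhammer\<close>.\<close>

lemma renewal_third_moment_bound:
  fixes f :: "nat \<Rightarrow> real"
  assumes q: "0 < q" "q < 1" and f0: "f 0 = 0" and nonneg: "\<And>n. 0 \<le> f n"
    and ren: "\<And>n. 0 < n \<Longrightarrow> q_pochhammer q n = (\<Sum>m=1..n. f m * q_pochhammer q (n - m))"
  obtains K \<rho> where "0 < \<rho>" "\<rho> < 1" "q \<le> \<rho>" "0 < K" "\<And>m. real m ^ 3 * f m \<le> K * \<rho> ^ m"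
proof -
  obtain z where z: "1 < z" "\<And>n. (\<Sum>j<n. q ^ Suc j * q_pochhammer q j * z ^ Suc j) \<le> 1"
    by (rule q_pochhammer_kernel_less_1[OF q]) (rule that)
  define T where "T n = 1 - (\<Sum>m\<le>n. f m)" for n
  have rec: "T (Suc n) = (\<Sum>j\<le>n. q ^ Suc j * q_pochhammer q j * T (n - j))" for n
    unfolding T_def by (rule renewal_tail_recursion) (use f0 ren in auto)
  have k0: "0 \<le> q ^ Suc j * q_pochhammer q j" for j
    using q q_pochhammer_pos[OF q, of j] by simp
  \<comment> \<open>By strong induction, \<open>T n * z ^ n\<close> is a combination of earlier such
    terms with nonnegative coefficients of total at most 1. Nonnegativity is carried along because
    it later gives \<open>f m \<le> T (m - 1)\<close>.\<close>
  have T: "0 \<le> T n \<and> T n * z ^ n \<le> 1" for n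
  proof (induction n rule: less_induct)
    case (less n)
    show ?case
    proof (cases n)
      case 0
      then show ?thesis by (simp add: T_def f0)
    next
      case (Suc k)
      have "T n * z ^ n = (\<Sum>j\<le>k. (q ^ Suc j * q_pochhammer q j * z ^ Suc j) * (T (k - j) * z ^ (k - j)))"
        unfolding Suc rec sum_distrib_right
      proof (rule sum.cong)
        fix j assume "j \<in> {..k}"
        then have "z ^ Suc k = z ^ Suc j * z ^ (k - j)" by (simp add: power_add[symmetric])
        then show "q ^ Suc j * q_pochhammer q j * T (k - j) * z ^ Suc k =
          q ^ Suc j * q_pochhammer q j * z ^ Suc j * (T (k - j) * z ^ (k - j))" by simp
      qed simp
      also have "\<dots> \<le> (\<Sum>j\<le>k. (q ^ Suc j * q_pochhammer q j * z ^ Suc j) * 1)"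
        using less Suc k0 z by (intro sum_mono mult_left_mono) auto
      also have "\<dots> \<le> 1" using z(2)[of "Suc k"] by (simp add: lessThan_Suc_atMost)
      finally have "T n * z ^ n \<le> 1" .
      moreover have "0 \<le> T n" unfolding Suc rec
        using less Suc by (intro sum_nonneg mult_nonneg_nonneg[OF k0]) auto
      ultimately show ?thesis by simp
    qed
  qed
  have fb: "f m \<le> z * (1 / z) ^ m" for m
  proof (cases m)
    case 0
    then show ?thesis using z f0 by simp
  next
    case (Suc k)
    have "f m = T k - T m" by (simp add: T_def Suc)
    also have "\<dots> \<le> T k" using T[of m] by simp
    also have "\<dots> \<le> (1 / z) ^ k" using T[of k] z by (simp add: field_simps power_one_over)
    also have "\<dots> = z * (1 / z) ^ m" using z by (simp add: Suc)
    finally show ?thesis .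
  qed
  define r where "r = max q (1 / z)"
  have r: "0 < r" "r < 1" using q z by (auto simp: r_def)
  obtain K \<rho> where K: "0 < \<rho>" "\<rho> < 1" "0 < K" "\<And>m. real m ^ 3 * r ^ m \<le> K * \<rho> ^ m"
    by (rule power3_geometric_bound[OF r]) (rule that)
  define \<rho>' where "\<rho>' = max q \<rho>"
  have "real m ^ 3 * f m \<le> (z * K) * \<rho>' ^ m" for m
  proof -
    have "real m ^ 3 * f m \<le> real m ^ 3 * (z * r ^ m)"
    proof (rule mult_left_mono)
      have "(1 / z) ^ m \<le> r ^ m" using z by (intro power_mono) (auto simp: r_def)
      then show "f m \<le> z * r ^ m" using fb[of m] z by (metis mult_left_mono order_trans less_imp_le zero_less_one less_trans)
    qed simp
    also have "\<dots> = z * (real m ^ 3 * r ^ m)" by simp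
    also have "\<dots> \<le> z * (K * \<rho> ^ m)" using K z by (intro mult_left_mono) auto
    also have "\<dots> \<le> z * (K * \<rho>' ^ m)"
      using K z by (intro mult_left_mono power_mono) (auto simp: \<rho>'_def)
    finally show ?thesis by simp
  qed
  moreover have "0 < \<rho>'" "\<rho>' < 1" "q \<le> \<rho>'" "0 < z * K" using K q z by (auto simp: \<rho>'_def)
  ultimately show ?thesis using that by blast
qed

text \<open>The generating functions satisfy the resolvent identity B - U = U D B. The coefficients
  of U D approach \<open>\<phi> * suminf d\<close> geometrically fast; replacing them by this limit
  produces the sum of the \<open>b j\<close>, and the summable replacement error is proportional to
  \<open>K\<close>.\<close>

lemma renewal_perturbation:
  fixes u f :: "nat \<Rightarrow> real" and d b :: "nat \<Rightarrow> complex"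
  assumes \<rho>: "0 < \<rho>" "\<rho> < 1" and nonneg: "0 \<le> \<phi>" "0 \<le> C" "0 \<le> K"
    and u0: "u 0 = 1" and f0: "f 0 = 0" and b0: "b 0 = 1" and d0: "d 0 = 0"
    and u_ren: "\<And>n. 0 < n \<Longrightarrow> u n = (\<Sum>m=1..n. f m * u (n - m))"
    and b_ren: "\<And>n. 0 < n \<Longrightarrow> b n = (\<Sum>m=1..n. (of_real (f m) + d m) * b (n - m))"
    and d_bound: "\<And>m. cmod (d m) \<le> K * \<rho> ^ m"
    and u_bound: "\<And>n. \<bar>u n - \<phi>\<bar> \<le> C * \<rho> ^ n"
    and b_bound: "\<And>n. cmod (b n) \<le> 1"
  shows "cmod (b N - u N - \<phi> * suminf d * (\<Sum>j\<le>N. b j)) \<le> K * (C + \<phi>) / (1 - \<rho>)\<^sup>2"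
proof -
  let ?u = "\<lambda>n. complex_of_real (u n)"
  let ?U = "Abs_fps ?u" and ?F = "Abs_fps (\<lambda>n. complex_of_real (f n))"
    and ?D = "Abs_fps d" and ?B = "Abs_fps b"
  have U: "?U * (1 - ?F) = 1"
    by (rule renewal_fps) (use u0 f0 in \<open>auto simp: u_ren\<close>)
  have "?B * (1 - Abs_fps (\<lambda>m. of_real (f m) + d m)) = 1"
    by (rule renewal_fps) (use b0 f0 d0 b_ren in auto)
  moreover have "Abs_fps (\<lambda>m. of_real (f m) + d m) = ?F + ?D" by (rule fps_ext) simp
  ultimately have B: "?B * (1 - ?F - ?D) = 1" by (simp add: algebra_simps)
  \<comment> \<open>Each series is multiplied by an expression equal to 1, namely the renewal
    equation of the other.\<close>
  have "?B - ?U = ?B * (?U * (1 - ?F)) - ?U * (?B * (1 - ?F - ?D))" unfolding U B by simp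
  also have "\<dots> = (?U * ?D) * ?B" by (simp add: algebra_simps)
  finally have BU: "?B - ?U = (?U * ?D) * ?B" .
  define h where "h j = (\<Sum>m\<le>j. ?u (j - m) * d m)" for j
  have h: "fps_nth (?U * ?D) j = h j" for j
    unfolding h_def by (subst mult.commute) (simp add: fps_mult_nth atLeast0AtMost mult.commute)
  have bN: "b N - u N = (\<Sum>j\<le>N. h j * b (N - j))"
    using arg_cong[OF BU, of "\<lambda>F. fps_nth F N"] by (simp add: fps_mult_nth[of "?U * ?D"] h atLeast0AtMost)
  have sums: "summable (\<lambda>m. K * \<rho> ^ m)" using \<rho> by (intro summable_mult summable_geometric) auto
  have sumn: "summable (\<lambda>m. cmod (d m))"
    by (rule summable_comparison_test'[OF sums, of 0]) (use d_bound in simp)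
  then have sumd: "summable d" by (rule summable_norm_cancel)
  \<comment> \<open>There are two errors: replacing \<open>u (j - m)\<close> by \<phi> costs a
    convolution of two geometric sequences, hence the factor \<open>Suc j\<close>, and completing
    the finite sum of \<open>d\<close> costs its tail.\<close>
  have hD: "cmod (h j - \<phi> * suminf d) \<le> C * K * (real (Suc j) * \<rho> ^ j) + \<phi> * K * \<rho> / (1 - \<rho>) * \<rho> ^ j" for j
  proof -
    have tail: "cmod (\<Sum>m. d (m + Suc j)) \<le> K * \<rho> ^ Suc j / (1 - \<rho>)"
    proof -
      have s: "(\<lambda>m. K * \<rho> ^ (m + Suc j)) sums (K * \<rho> ^ Suc j / (1 - \<rho>))"
        using sums_mult[OF geometric_sums[of \<rho>], of "K * \<rho> ^ Suc j"] \<rho> by (simp add: power_add mult_ac)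
      have "cmod (\<Sum>m. d (m + Suc j)) \<le> (\<Sum>m. cmod (d (m + Suc j)))"
        using sumn by (intro summable_norm summable_ignore_initial_segment)
      also have "\<dots> \<le> (\<Sum>m. K * \<rho> ^ (m + Suc j))"
        by (intro suminf_le summable_ignore_initial_segment sumn d_bound sums_summable[OF s])
      finally show ?thesis using s by (simp add: sums_iff)
    qed
    have "h j - \<phi> * suminf d = (\<Sum>m\<le>j. of_real (u (j - m) - \<phi>) * d m) - \<phi> * (\<Sum>m. d (m + Suc j))"
      using suminf_split_initial_segment[OF sumd, of "Suc j"]
      by (simp add: h_def lessThan_Suc_atMost algebra_simps sum_subtractf sum_distrib_left)
    also have "cmod \<dots> \<le> cmod (\<Sum>m\<le>j. of_real (u (j - m) - \<phi>) * d m) + cmod (\<phi> * (\<Sum>m. d (m + Suc j)))"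
      by (rule norm_triangle_ineq4)
    also have "cmod (\<Sum>m\<le>j. of_real (u (j - m) - \<phi>) * d m) \<le> (\<Sum>m\<le>j. (C * \<rho> ^ (j - m)) * (K * \<rho> ^ m))"
    proof (rule order_trans[OF norm_sum sum_mono])
      show "cmod (of_real (u (j - m) - \<phi>) * d m) \<le> (C * \<rho> ^ (j - m)) * (K * \<rho> ^ m)" for m
        unfolding norm_mult norm_of_real by (intro mult_mono u_bound d_bound) (use nonneg \<rho> in auto)
    qed
    also have "\<dots> = (\<Sum>m\<le>j. C * K * \<rho> ^ j)"
      by (intro sum.cong) (auto simp: power_add[symmetric] mult_ac)
    also have "cmod (\<phi> * (\<Sum>m. d (m + Suc j))) \<le> \<phi> * (K * \<rho> ^ Suc j / (1 - \<rho>))"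
      unfolding norm_mult norm_of_real using nonneg by (intro mult_mono tail) auto
    finally show ?thesis by (simp add: mult_ac)
  qed
  have "b N - u N - \<phi> * suminf d * (\<Sum>j\<le>N. b j) = (\<Sum>j\<le>N. (h j - \<phi> * suminf d) * b (N - j))"
  proof -
    have "(\<Sum>j\<le>N. b j) = (\<Sum>j\<le>N. b (N - j))"
      by (rule sum.reindex_bij_witness[of _ "\<lambda>j. N - j" "\<lambda>j. N - j"]) auto
    then show ?thesis unfolding bN by (simp add: left_diff_distrib sum_subtractf sum_distrib_left)
  qed
  also have "cmod \<dots> \<le> (\<Sum>j\<le>N. cmod (h j - \<phi> * suminf d) * 1)"
    by (rule order_trans[OF norm_sum sum_mono]) (simp add: norm_mult mult_left_le b_bound)
  also have "\<dots> \<le> (\<Sum>j\<le>N. C * K * (real (Suc j) * \<rho> ^ j) + \<phi> * K * \<rho> / (1 - \<rho>) * \<rho> ^ j)"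
    using hD by (intro sum_mono) simp
  also have "\<dots> \<le> C * K * (1 / (1 - \<rho>)\<^sup>2) + \<phi> * K * \<rho> / (1 - \<rho>) * (1 / (1 - \<rho>))"
  proof -
    have s: "(\<lambda>j. C * K * (real (Suc j) * \<rho> ^ j) + \<phi> * K * \<rho> / (1 - \<rho>) * \<rho> ^ j)
      sums (C * K * (1 / (1 - \<rho>)\<^sup>2) + \<phi> * K * \<rho> / (1 - \<rho>) * (1 / (1 - \<rho>)))"
      using \<rho> by (intro sums_add sums_mult geometric_sums geometric_deriv_sums) auto
    show ?thesis unfolding sums_unique[OF s]
      by (rule sum_le_suminf[OF sums_summable[OF s]])
        (use nonneg \<rho> in \<open>auto intro!: add_nonneg_nonneg mult_nonneg_nonneg\<close>)
  qed
  also have "\<dots> = K * (C + \<phi> * \<rho>) / (1 - \<rho>)\<^sup>2"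
    using \<rho> by (simp add: power2_eq_square add_divide_distrib algebra_simps)
  also have "\<dots> \<le> K * (C + \<phi>) / (1 - \<rho>)\<^sup>2"
    using nonneg \<rho> by (intro divide_right_mono mult_left_mono add_left_mono) (auto simp: mult_left_le)
  finally show ?thesis .
qed

subsection \<open>A perturbed linear recursion\<close>

lemma cmod_one_minus_ge_1:
  assumes "Re w \<le> 0"
  shows "1 \<le> cmod (1 - w)"
  using complex_Re_le_cmod[of "1 - w"] assms by simp

text \<open>Both functions are compared with their common linear part 1 + w, at costs of one and
  three times the square of the modulus.\<close>

lemma norm_inverse_one_minus_exp:
  assumes "Re w \<le> 0" "cmod w \<le> 1"
  shows "cmod (1 / (1 - w) - exp w) \<le> 4 * (cmod w)\<^sup>2"
proof -
  have ge: "1 \<le> cmod (1 - w)" by (rule cmod_one_minus_ge_1[OF assms(1)])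
  then have ne: "1 - w \<noteq> 0" by auto
  have "1 / (1 - w) - (1 + w) = w\<^sup>2 / (1 - w)"
    using ne by (simp add: field_simps power2_eq_square)
  then have "cmod (1 / (1 - w) - (1 + w)) = (cmod w)\<^sup>2 / cmod (1 - w)"
    by (simp add: norm_divide norm_power)
  also have "\<dots> \<le> (cmod w)\<^sup>2" using ge by (simp add: divide_le_eq mult_le_cancel_left1)
  finally have 1: "cmod (1 / (1 - w) - (1 + w)) \<le> (cmod w)\<^sup>2" .
  have "cmod (exp w - (\<Sum>k\<le>1. w ^ k / fact k)) \<le> exp \<bar>Re w\<bar> * (cmod w) ^ Suc 1 / fact 1"
    by (rule Taylor_exp)
  also have "\<dots> \<le> 3 * (cmod w)\<^sup>2"
  proof -
    have "exp \<bar>Re w\<bar> \<le> exp 1" using abs_Re_le_cmod[of w] assms by simp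
    also have "\<dots> \<le> (3::real)" by (rule exp_le)
    finally show ?thesis by (simp add: numeral_2_eq_2 mult_right_mono)
  qed
  finally have 2: "cmod (exp w - (1 + w)) \<le> 3 * (cmod w)\<^sup>2" by simp
  have "1 / (1 - w) - exp w = (1 / (1 - w) - (1 + w)) - (exp w - (1 + w))" by simp
  also have "cmod \<dots> \<le> cmod (1 / (1 - w) - (1 + w)) + cmod (exp w - (1 + w))" by (rule norm_triangle_ineq4)
  finally show ?thesis using 1 2 by simp
qed

text \<open>A nonpositive real part puts both \<open>1 / (1 - w n)\<close> and
  \<open>exp (w n)\<close> in the closed unit disc, so their powers differ by at most
  \<open>Suc n\<close> times the difference of the bases, which is quadratic in
  \<open>w n\<close>.\<close>

lemma tendsto_inverse_one_minus_power:
  fixes w :: "nat \<Rightarrow> complex"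
  assumes re: "\<And>n. Re (w n) \<le> 0" and lim: "(\<lambda>n. of_nat n * w n) \<longlonglongrightarrow> g"
  shows "(\<lambda>n. (1 / (1 - w n)) ^ Suc n) \<longlonglongrightarrow> exp g"
proof -
  have "(\<lambda>n. of_nat n * w n * of_real (1 / real n)) \<longlonglongrightarrow> g * of_real 0"
    by (intro tendsto_mult lim tendsto_of_real lim_1_over_n)
  moreover have "eventually (\<lambda>n. of_nat n * w n * of_real (1 / real n) = w n) sequentially"
    using eventually_gt_at_top[of 0] by eventually_elim simp
  ultimately have w0: "w \<longlonglongrightarrow> 0" by (simp add: tendsto_cong)
  have Suc_w: "(\<lambda>n. of_nat (Suc n) * w n) \<longlonglongrightarrow> g"
    using tendsto_add[OF lim w0] by (simp add: algebra_simps)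
  have small: "eventually (\<lambda>n. cmod (w n) \<le> 1) sequentially"
    using order_tendstoD(2)[OF tendsto_norm[OF w0], of 1] by (auto elim: eventually_mono)
  have "(\<lambda>n. (1 / (1 - w n)) ^ Suc n - exp (w n) ^ Suc n) \<longlonglongrightarrow> 0"
  proof (rule Lim_null_comparison)
    show "eventually (\<lambda>n. norm ((1 / (1 - w n)) ^ Suc n - exp (w n) ^ Suc n)
       \<le> 4 * cmod (of_nat (Suc n) * w n) * cmod (w n)) sequentially"
      using small
    proof eventually_elim
      case (elim n)
      have "cmod (1 / (1 - w n)) \<le> 1"
        using cmod_one_minus_ge_1[OF re[of n]] by (simp add: norm_divide divide_le_eq)
      moreover have "cmod (exp (w n)) \<le> 1" using re by simp
      ultimately have "cmod ((1 / (1 - w n)) ^ Suc n - exp (w n) ^ Suc n) \<le> Suc n * cmod (1 / (1 - w n) - exp (w n))"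
        by (rule norm_power_diff)
      also have "\<dots> \<le> Suc n * (4 * (cmod (w n))\<^sup>2)"
        by (intro mult_left_mono norm_inverse_one_minus_exp re elim) auto
      also have "\<dots> = 4 * cmod (of_nat (Suc n) * w n) * cmod (w n)"
        by (simp only: norm_mult norm_of_nat power2_eq_square mult_ac)
      finally show ?case .
    qed
    from tendsto_mult[OF tendsto_mult[OF tendsto_const[of 4] tendsto_norm[OF Suc_w]] tendsto_norm[OF w0]]
    show "(\<lambda>n. 4 * cmod (of_nat (Suc n) * w n) * cmod (w n)) \<longlonglongrightarrow> 0" by simp
  qed
  moreover have "(\<lambda>n. exp (w n) ^ Suc n) \<longlonglongrightarrow> exp g"
    using tendsto_exp[OF Suc_w] by (simp only: exp_of_nat_mult)
  ultimately show ?thesis using tendsto_add by fastforce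
qed

text \<open>
  With \<open>w = \<phi> D\<close>, the errors \<open>e k = b k - x k\<close> satisfy \<open>x k * (1 - w) = x (k - 1) + w * e k\<close>, so \<open>x\<close> is nearly geometric.
\<close>

lemma linear_recursion_perturbation:
  fixes b :: "nat \<Rightarrow> complex" and \<phi> w :: complex
  assumes w: "Re w \<le> 0"
  defines "x \<equiv> \<lambda>k. \<phi> + w * (\<Sum>j\<le>k. b j)"
  shows "cmod (x k - \<phi> * (1 / (1 - w)) ^ Suc k) \<le> cmod w * (\<Sum>j\<le>k. cmod (b j - x j))"
proof -
  have ge: "1 \<le> cmod (1 - w)" by (rule cmod_one_minus_ge_1[OF w])
  then have ne: "1 - w \<noteq> 0" by auto
  \<comment> \<open>Division by \<open>1 - w\<close> does not increase the modulus, so the errors of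
    successive steps merely add up.\<close>
  have div: "cmod (z / (1 - w)) \<le> cmod z" for z
    using mult_left_mono[OF ge, of "cmod z"] ge by (simp add: norm_divide divide_le_eq)
  show ?thesis
  proof (induction k)
    case 0
    have "x 0 * (1 - w) = \<phi> + w * (b 0 - x 0)" by (simp add: x_def algebra_simps)
    then have "x 0 - \<phi> * (1 / (1 - w)) ^ Suc 0 = w * (b 0 - x 0) / (1 - w)"
      using ne by (simp add: field_simps)
    then show ?case using div[of "w * (b 0 - x 0)"] by (simp add: norm_mult)
  next
    case (Suc k)
    have "x (Suc k) * (1 - w) = x k + w * (b (Suc k) - x (Suc k))" by (simp add: x_def algebra_simps)
    then have "x (Suc k) = (x k + w * (b (Suc k) - x (Suc k))) / (1 - w)"
      using ne by (simp add: field_simps)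
    then have "x (Suc k) - \<phi> * (1 / (1 - w)) ^ Suc (Suc k) =
      (x k - \<phi> * (1 / (1 - w)) ^ Suc k + w * (b (Suc k) - x (Suc k))) / (1 - w)"
      by (simp add: diff_divide_distrib add_divide_distrib)
    then have "cmod (x (Suc k) - \<phi> * (1 / (1 - w)) ^ Suc (Suc k)) \<le>
      cmod (x k - \<phi> * (1 / (1 - w)) ^ Suc k + w * (b (Suc k) - x (Suc k)))" using div by metis
    also have "\<dots> \<le> cmod (x k - \<phi> * (1 / (1 - w)) ^ Suc k) + cmod w * cmod (b (Suc k) - x (Suc k))"
      unfolding norm_mult[symmetric] by (rule norm_triangle_ineq)
    finally show ?case using Suc by (simp add: distrib_left)
  qed
qed

text \<open>The accumulated errors up to \<open>n\<close> are O(sqrt n) and enter with a factor of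
  order 1/n, hence vanish. What remains is the geometric solution, whose power converges to an
  exponential.\<close>

lemma linear_recursion_limit:
  fixes b :: "nat \<Rightarrow> nat \<Rightarrow> complex" and D :: "nat \<Rightarrow> complex" and g :: complex
    and \<phi> \<rho> C M :: real
  assumes \<rho>: "0 < \<rho>" "\<rho> < 1" and "0 \<le> \<phi>" "0 \<le> C"
    and re: "\<And>n. Re (D n) \<le> 0" and lim: "(\<lambda>n. of_nat n * D n) \<longlonglongrightarrow> g"
    and err: "\<And>n k. cmod (b n k - (\<phi> + \<phi> * D n * (\<Sum>j\<le>k. b n j))) \<le> C * \<rho> ^ k + M / sqrt n"
  shows "(\<lambda>n. b n n) \<longlonglongrightarrow> \<phi> * exp (\<phi> * g)"
proof -
  define w where "w n = \<phi> * D n" for n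
  define x where "x n k = \<phi> + w n * (\<Sum>j\<le>k. b n j)" for n k
  have re_w: "Re (w n) \<le> 0" for n
    using re[of n] \<open>0 \<le> \<phi>\<close> by (simp add: w_def mult_nonneg_nonpos)
  have lim_w: "(\<lambda>n. of_nat n * w n) \<longlonglongrightarrow> \<phi> * g"
    using tendsto_mult[OF tendsto_const[of "complex_of_real \<phi>"] lim] by (simp add: w_def mult_ac)
  have e: "cmod (b n k - x n k) \<le> C * \<rho> ^ k + M / sqrt n" for n k
    using err[of n k] by (simp add: x_def w_def)
  have sum_e: "(\<Sum>j\<le>n. cmod (b n j - x n j)) \<le> C / (1 - \<rho>) + (real n + 1) * (M / sqrt n)" for n
  proof -
    have "(\<Sum>j\<le>n. cmod (b n j - x n j)) \<le> (\<Sum>j\<le>n. C * \<rho> ^ j + M / sqrt n)" by (intro sum_mono e)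
    also have "\<dots> = C * (\<Sum>j\<le>n. \<rho> ^ j) + (real n + 1) * (M / sqrt n)"
      by (simp add: sum.distrib sum_distrib_left)
    also have "(\<Sum>j\<le>n. \<rho> ^ j) \<le> (\<Sum>j. \<rho> ^ j)"
      using \<rho> by (intro sum_le_suminf summable_geometric) auto
    also have "\<dots> = 1 / (1 - \<rho>)" using \<rho> by (intro suminf_geometric) auto
    finally show ?thesis using \<open>0 \<le> C\<close> by (simp add: mult_left_mono)
  qed
  have "(\<lambda>n. b n n - \<phi> * (1 / (1 - w n)) ^ Suc n) \<longlonglongrightarrow> 0"
  proof (rule Lim_null_comparison)
    show "eventually (\<lambda>n. cmod (b n n - \<phi> * (1 / (1 - w n)) ^ Suc n) \<le>
      (C * \<rho> ^ n + M / sqrt n) + cmod (of_nat n * w n) * (C / (1 - \<rho>) / n + (real n + 1) / n * (M / sqrt n))) sequentially"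
      using eventually_gt_at_top[of 0]
    proof eventually_elim
      case (elim n)
      have "b n n - \<phi> * (1 / (1 - w n)) ^ Suc n = (b n n - x n n) + (x n n - \<phi> * (1 / (1 - w n)) ^ Suc n)"
        by simp
      also have "cmod \<dots> \<le> cmod (b n n - x n n) + cmod (x n n - \<phi> * (1 / (1 - w n)) ^ Suc n)"
        by (rule norm_triangle_ineq)
      also have "\<dots> \<le> (C * \<rho> ^ n + M / sqrt n) + cmod (w n) * (C / (1 - \<rho>) + (real n + 1) * (M / sqrt n))"
      proof (rule add_mono[OF e])
        show "cmod (x n n - \<phi> * (1 / (1 - w n)) ^ Suc n) \<le> cmod (w n) * (C / (1 - \<rho>) + (real n + 1) * (M / sqrt n))"
          using linear_recursion_perturbation[OF re_w[of n], of \<phi> "b n" n] mult_left_mono[OF sum_e[of n], of "cmod (w n)"]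
          by (simp add: x_def)
      qed
      also have "cmod (w n) * (C / (1 - \<rho>) + (real n + 1) * (M / sqrt n)) =
        cmod (of_nat n * w n) * (C / (1 - \<rho>) / n + (real n + 1) / n * (M / sqrt n))"
        using elim by (simp add: norm_mult distrib_left)
      finally show ?case .
    qed
    have 1: "(\<lambda>n. C * \<rho> ^ n + M / sqrt n) \<longlonglongrightarrow> 0" using \<rho> by real_asymp
    have 2: "(\<lambda>n. C / (1 - \<rho>) / n + (real n + 1) / n * (M / sqrt n)) \<longlonglongrightarrow> 0" by real_asymp
    show "(\<lambda>n. (C * \<rho> ^ n + M / sqrt n) + cmod (of_nat n * w n) * (C / (1 - \<rho>) / n + (real n + 1) / n * (M / sqrt n))) \<longlonglongrightarrow> 0"
      using tendsto_add[OF 1 tendsto_mult[OF tendsto_norm[OF lim_w] 2]] by simp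
  qed
  moreover have "(\<lambda>n. \<phi> * (1 / (1 - w n)) ^ Suc n) \<longlonglongrightarrow> \<phi> * exp (\<phi> * g)"
    by (intro tendsto_mult tendsto_const tendsto_inverse_one_minus_power re_w lim_w)
  ultimately show ?thesis using tendsto_add by fastforce
qed

subsection \<open>Weights of indecomposable blocks\<close>

text \<open>The factor \<open>(1 - q) ^ length xs\<close> cancels the denominators of the
  q-integers, so total weights converge to a positive limit. It is constant on permutations of a
  given size and therefore does not change the Mallows law.\<close>

definition list_weight :: "real \<Rightarrow> nat list \<Rightarrow> real" where
  "list_weight q xs = (1 - q) ^ length xs * q ^ list_inv xs"

definition indec_weight :: "real \<Rightarrow> nat \<Rightarrow> real" where
  "indec_weight q m = (\<Sum>xs\<in>indecomposables m. list_weight q xs)"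

definition indec_moment :: "real \<Rightarrow> (nat list \<Rightarrow> real) \<Rightarrow> nat \<Rightarrow> real" where
  "indec_moment q g m = (\<Sum>xs\<in>indecomposables m. list_weight q xs * g xs)"

lemma list_weight_pos: "0 < q \<Longrightarrow> q < 1 \<Longrightarrow> 0 < list_weight q xs"
  by (simp add: list_weight_def)

lemma length_indecomposables: "xs \<in> indecomposables m \<Longrightarrow> length xs = m"
  by (auto simp: indecomposables_def dest: length_finite_permutations_of_set)

lemma length_direct_sum: "length (direct_sum xs ys) = length xs + length ys"
  by (simp add: direct_sum_def)

lemma list_weight_direct_sum:
  assumes "xs \<in> permutations_of_set {1..m}" "ys \<in> permutations_of_set {1..k}"
  shows "list_weight q (direct_sum xs ys) = list_weight q xs * list_weight q ys"
  by (simp add: list_weight_def length_direct_sum list_inv_direct_sum[OF assms] power_add mult_ac)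

lemma sum_list_weight: 
  "(\<Sum>xs\<in>permutations_of_set {1..n}. list_weight q xs) = q_pochhammer q n"
proof -
  have "(\<Sum>xs\<in>permutations_of_set {1..n}. list_weight q xs)
      = (1 - q) ^ n * (\<Sum>xs\<in>permutations_of_set {1..n}. q ^ list_inv xs)"
    unfolding sum_distrib_left list_weight_def
    by (intro sum.cong) (auto dest: length_finite_permutations_of_set)
  also have "\<dots> = (\<Prod>i=1..n. 1 - q) * (\<Prod>i=1..n. \<Sum>j<i. q ^ j)"
    by (subst sum_permutations_list_inv) simp_all
  also have "\<dots> = q_pochhammer q n"
    unfolding q_pochhammer_def prod.distrib[symmetric] by (intro prod.cong refl one_diff_power_eq[symmetric])
  finally show ?thesis .
qed

lemma indecomposables_0: "indecomposables 0 = {}"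
  by (simp add: indecomposables_def)

lemma indec_weight_0: "indec_weight q 0 = 0"
  by (simp add: indec_weight_def indecomposables_0)

lemma indec_weight_nonneg: "0 < q \<Longrightarrow> q < 1 \<Longrightarrow> 0 \<le> indec_weight q m"
  unfolding indec_weight_def by (intro sum_nonneg less_imp_le list_weight_pos)

lemma q_pochhammer_renewal:
  "0 < n \<Longrightarrow> q_pochhammer q n = (\<Sum>m=1..n. indec_weight q m * q_pochhammer q (n - m))"
  unfolding sum_list_weight[symmetric] indec_weight_def
  by (rule sum_permutations_renewal) (simp_all add: list_weight_direct_sum)

lemma indec_moment_bound:
  assumes q: "0 < q" "q < 1" and "\<And>xs. \<bar>g xs\<bar> \<le> real (length xs) ^ k"
  shows "\<bar>indec_moment q g m\<bar> \<le> real m ^ k * indec_weight q m"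
proof -
  have "\<bar>indec_moment q g m\<bar> \<le> (\<Sum>xs\<in>indecomposables m. \<bar>list_weight q xs * g xs\<bar>)"
    unfolding indec_moment_def by (rule sum_abs)
  also have "\<dots> \<le> (\<Sum>xs\<in>indecomposables m. list_weight q xs * real m ^ k)"
  proof (rule sum_mono)
    fix xs assume "xs \<in> indecomposables m"
    then show "\<bar>list_weight q xs * g xs\<bar> \<le> list_weight q xs * real m ^ k"
      using assms(3)[of xs] list_weight_pos[OF q, of xs] by (simp add: abs_mult length_indecomposables)
  qed
  finally show ?thesis
    by (simp add: indec_weight_def sum_distrib_right[symmetric] mult.commute)
qed

lemma power_le_cube: "k \<le> 3 \<Longrightarrow> 0 < m \<Longrightarrow> real m ^ k \<le> real m ^ 3"
  by (rule power_increasing) auto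

lemma centred_lis_bound:
  assumes "0 \<le> a" "a \<le> 1"
  shows "\<bar>real (list_lis xs) - a * real (length xs)\<bar> \<le> real (length xs)"
proof -
  have "0 \<le> a * real (length xs)" "a * real (length xs) \<le> real (length xs)"
    using assms by (auto intro: mult_left_le_one_le)
  then show ?thesis using list_lis_le_length[of xs] by linarith
qed

section \<open>The two smallest indecomposable blocks\<close>

lemma indec_1: "indecomposables 1 = {[1]}"
  by (auto simp: indecomposables_def)

lemma indec_2: "[2, 1] \<in> indecomposables 2"
proof -
  have "set (take k [2, 1]) \<noteq> {1..k}" if "k \<in> {0<..<2}" for k :: nat
  proof -
    have "k = 1" using that by auto
    then show ?thesis by simp
  qed
  moreover have "[2, 1] \<in> permutations_of_set {1..2::nat}"
    by (rule permutations_of_setI) auto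
  ultimately show ?thesis by (simp only: indecomposables_def mem_Collect_eq) simp
qed

lemma list_lis_singleton: "list_lis [x] = 1"
proof (rule antisym)
  show "list_lis [x] \<le> 1" using list_lis_le_length[of "[x]"] by simp
  show "1 \<le> list_lis [x]" using le_list_lis[of "[x]" "[x]"] by simp
qed

lemma list_lis_21: "list_lis [2, 1::nat] = 1"
proof (rule antisym)
  show "list_lis [2, 1::nat] \<le> 1"
  proof (rule list_lis_le, rule ccontr)
    fix ys assume ys: "subseq ys [2, 1::nat]" "sorted_wrt (<) ys" "\<not> length ys \<le> 1"
    then have "length ys = 2" using list_emb_length[OF ys(1)] by simp
    then have "ys = [2, 1]" using subseq_same_length[OF ys(1)] by simp
    with ys show False by simp
  qed
  show "1 \<le> list_lis [2, 1::nat]" using le_list_lis[of "[1]" "[2, 1::nat]"] by simp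
qed

text \<open>
  The drift \<open>a\<close> is the ratio of the mean subsequence length to the mean size of an indecomposable block,
  so that the centred block score \<open>list_lis xs - a * length xs\<close> has mean zero.
  The variance \<open>v\<close> is positive because the blocks \<open>[1]\<close> and \<open>[2, 1]\<close> have the same \<open>list_lis\<close> but different lengths.
\<close>

lemma centring_constants:
  assumes q: "0 < q" "q < 1"
    and K: "0 < \<rho>" "\<rho> < 1" "\<And>m. real m ^ 3 * indec_weight q m \<le> K * \<rho> ^ m"
  obtains a v where "0 < a" "a \<le> 1" "0 < v"
    "indec_moment q (\<lambda>xs. real (list_lis xs) - a * real (length xs)) sums 0"
    "indec_moment q (\<lambda>xs. (real (list_lis xs) - a * real (length xs))\<^sup>2) sums v"
proof -
  have geom: "summable (\<lambda>m. K * \<rho> ^ m)" using K by (intro summable_mult summable_geometric) auto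
  \<comment> \<open>Every block statistic of growth at most cubic in the block size has a summable
    moment series.\<close>
  have summ: "summable (indec_moment q g)" if g: "\<And>xs. \<bar>g xs\<bar> \<le> real (length xs) ^ k" and "k \<le> 3" for g k
  proof (rule summable_comparison_test'[OF geom, of 0])
    fix m :: nat
    show "norm (indec_moment q g m) \<le> K * \<rho> ^ m"
    proof (cases m)
      case 0
      then show ?thesis using K(3)[of 0] by (simp add: indec_moment_def indecomposables_0)
    next
      case (Suc i)
      have "norm (indec_moment q g m) \<le> real m ^ k * indec_weight q m"
        using indec_moment_bound[OF q g] by simp
      also have "\<dots> \<le> real m ^ 3 * indec_weight q m"
        using indec_weight_nonneg[OF q] Suc \<open>k \<le> 3\<close> by (intro mult_right_mono power_le_cube) auto
      finally show ?thesis using K(3)[of m] by simp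
    qed
  qed
  have nonneg: "0 \<le> indec_moment q g m" if "\<And>xs. 0 \<le> g xs" for g m
    unfolding indec_moment_def using that list_weight_pos[OF q] 
    by (intro sum_nonneg mult_nonneg_nonneg) (auto intro: less_imp_le)
  have pos: "0 < suminf (indec_moment q g)" 
    if "\<And>xs. 0 \<le> g xs" "summable (indec_moment q g)" "xs \<in> indecomposables m" "0 < g xs" for g m xs
  proof (rule suminf_pos2[OF that(2)])
    show "0 \<le> indec_moment q g n" for n by (rule nonneg[OF that(1)])
    show "0 < indec_moment q g m"
      unfolding indec_moment_def using that list_weight_pos[OF q]
      by (intro sum_pos2[OF finite_indecomposables that(3)] mult_pos_pos mult_nonneg_nonneg)
        (auto intro: less_imp_le)
  qed
  let ?Y = "indec_moment q (\<lambda>xs. real (list_lis xs))" and ?X = "indec_moment q (\<lambda>xs. real (length xs))"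
  have Y: "summable ?Y" by (rule summ[of _ 1]) (simp_all add: list_lis_le_length)
  have X: "summable ?X" by (rule summ[of _ 1]) simp_all
  have Ypos: "0 < suminf ?Y" by (rule pos[OF _ Y, of "[1]" 1]) (auto simp: indec_1[simplified] list_lis_singleton)
  have Xpos: "0 < suminf ?X" by (rule pos[OF _ X, of "[1]" 1]) (auto simp: indec_1[simplified])
  have YX: "suminf ?Y \<le> suminf ?X"
    unfolding indec_moment_def
    by (intro suminf_le[OF _ Y[unfolded indec_moment_def] X[unfolded indec_moment_def]] sum_mono
        mult_left_mono of_nat_mono list_lis_le_length less_imp_le[OF list_weight_pos[OF q]])
  define a where "a = suminf ?Y / suminf ?X"
  have a: "0 < a" "a \<le> 1" using Ypos Xpos YX by (simp_all add: a_def)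
  let ?V = "\<lambda>xs. real (list_lis xs) - a * real (length xs)"
  have mom: "indec_moment q ?V m = ?Y m - a * ?X m" for m
    by (simp add: indec_moment_def sum_distrib_left sum_subtractf[symmetric] algebra_simps)
  have "(\<lambda>m. ?Y m - a * ?X m) sums (suminf ?Y - a * suminf ?X)"
    by (intro sums_diff sums_mult summable_sums X Y)
  also have "suminf ?Y - a * suminf ?X = 0" using Xpos by (simp add: a_def)
  finally have zero: "indec_moment q ?V sums 0" by (simp add: mom[symmetric])
  have Vb: "\<bar>?V xs\<bar> \<le> real (length xs)" for xs :: "nat list"
    using a by (intro centred_lis_bound) auto
  have V2: "summable (indec_moment q (\<lambda>xs. (?V xs)\<^sup>2))"
    by (rule summ[of _ 2]) (use Vb in \<open>auto simp: abs_le_square_iff[symmetric]\<close>)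
  have vpos: "0 < suminf (indec_moment q (\<lambda>xs. (?V xs)\<^sup>2))"
  \<comment> \<open>The block \<open>[1]\<close> has score 1 - a, which serves unless
    \<open>a = 1\<close>; in that case \<open>[2, 1]\<close> has score -1.\<close>
  proof (cases "a = 1")
    case True
    show ?thesis by (rule pos[OF _ V2 indec_2]) (simp_all add: list_lis_21[simplified] True)
  next
    case False
    show ?thesis by (rule pos[OF _ V2, of "[1]" 1]) (use False in \<open>auto simp: indec_1[simplified] list_lis_singleton\<close>)
  qed
  show ?thesis
    by (rule that[OF a vpos zero summable_sums[OF V2]])
qed

subsection \<open>The characteristic function\<close>

text \<open>The sum is left unnormalised because its terms multiply over direct sums, which is what
  yields a renewal equation.\<close>

definition char_numerator :: "real \<Rightarrow> real \<Rightarrow> real \<Rightarrow> nat \<Rightarrow> complex" where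
  "char_numerator q a t n = (\<Sum>xs\<in>permutations_of_set {1..n}.
     of_real (list_weight q xs) * iexp (t * (real (list_lis xs) - a * real n)))"

section \<open>Passing from the Mallows measure to weighted lists\<close>

lemma sum_permutes_list:
  "(\<Sum>\<pi> | \<pi> permutes {1..n}. g (map \<pi> [1..<Suc n])) = (\<Sum>xs\<in>permutations_of_set {1..n}. g xs)"
  by (rule sum.reindex_bij_betw[OF bij_betw_permutes_lists])

lemma mallows_Z_eq: "(1 - q) ^ n * mallows_Z n q = q_pochhammer q n"
proof -
  have "(1 - q) ^ n * mallows_Z n q = (\<Sum>\<pi> | \<pi> permutes {1..n}. list_weight q (map \<pi> [1..<Suc n]))"
    by (simp add: mallows_Z_def list_weight_def inv_count_eq_list_inv sum_distrib_left del: upt_Suc)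
  also have "\<dots> = q_pochhammer q n" unfolding sum_permutes_list by (rule sum_list_weight)
  finally show ?thesis .
qed

lemma char_mallows:
  assumes q: "0 < q" "q < 1"
  shows "char (distr (mallows n q) borel (\<lambda>\<pi>. (real (lis_length n \<pi>) - a * real n) / c)) t
    = char_numerator q a (t / c) n / q_pochhammer q n"
proof -
  let ?X = "\<lambda>\<pi>. (real (lis_length n \<pi>) - a * real n) / c"
  define g where "g xs = of_real (list_weight q xs) *
    iexp (t / c * (real (list_lis xs) - a * real n)) / q_pochhammer q n" for xs
  have "char (distr (mallows n q) borel ?X) t = (CLINT \<pi>|mallows n q. iexp (t * ?X \<pi>))"
    unfolding char_def by (rule integral_distr) auto
  also have "\<dots> = (\<Sum>\<pi> | \<pi> permutes {1..n}. pmf (mallows n q) \<pi> *\<^sub>R iexp (t * ?X \<pi>))"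
    by (rule integral_measure_pmf) (auto simp: finite_permutations set_pmf_iff pmf_mallows[OF q(1)] split: if_splits)
  also have "\<dots> = (\<Sum>\<pi> | \<pi> permutes {1..n}. g (map \<pi> [1..<Suc n]))"
  proof (rule sum.cong)
    fix \<pi> :: "nat \<Rightarrow> nat" assume "\<pi> \<in> {\<pi>. \<pi> permutes {1..n}}"
    then have "pmf (mallows n q) \<pi> = q ^ inv_count n \<pi> / mallows_Z n q"
      by (simp add: pmf_mallows[OF q(1)])
    \<comment> \<open>Numerator and denominator are both multiplied by
      \<open>(1 - q) ^ n\<close>.\<close>
    also have "\<dots> = list_weight q (map \<pi> [1..<Suc n]) / q_pochhammer q n"
      using q by (simp add: list_weight_def inv_count_eq_list_inv mallows_Z_eq[symmetric] del: upt_Suc)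
    finally show "pmf (mallows n q) \<pi> *\<^sub>R iexp (t * ?X \<pi>) = g (map \<pi> [1..<Suc n])"
      by (simp add: g_def scaleR_conv_of_real lis_length_eq_list_lis del: upt_Suc)
  qed simp
  also have "\<dots> = char_numerator q a (t / c) n / q_pochhammer q n"
    unfolding sum_permutes_list unfolding g_def char_numerator_def by (simp add: sum_divide_distrib)
  finally show ?thesis .
qed

text \<open>The returned variance is \<open>\<phi> * v\<close>: the block variance times the
  limiting renewal density. The block transform is a perturbation of the block weights, small and
  explicit to second order in \<open>t\<close>, so the two preceding recursion results apply at
  \<open>t = s / sqrt n\<close>.\<close>

lemma char_numerator_limit:
  assumes q: "0 < q" "q < 1"
  obtains a v where "0 < a" "0 < v"
    "\<And>s. (\<lambda>n. char_numerator q a (s / sqrt n) n / q_pochhammer q n) \<longlonglongrightarrow> complex_of_real (exp (- v * s\<^sup>2 / 2))"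
proof -
  obtain \<phi> where \<phi>: "0 < \<phi>" "\<phi> \<le> 1" "q_pochhammer q \<longlonglongrightarrow> \<phi>"
    "\<And>n. \<bar>q_pochhammer q n - \<phi>\<bar> \<le> q ^ n / (1 - q)" by (rule q_pochhammer_limit[OF q]) (rule that)
  obtain K \<rho> where \<rho>: "0 < \<rho>" "\<rho> < 1" "q \<le> \<rho>" "0 < K"
    and K: "\<And>m. real m ^ 3 * indec_weight q m \<le> K * \<rho> ^ m"
    by (rule renewal_third_moment_bound[OF q indec_weight_0 indec_weight_nonneg[OF q] q_pochhammer_renewal],
        assumption, rule that)
  obtain a v where a: "0 < a" "a \<le> 1" and v: "0 < v"
    and zero: "indec_moment q (\<lambda>xs. real (list_lis xs) - a * real (length xs)) sums 0"
    and var: "indec_moment q (\<lambda>xs. (real (list_lis xs) - a * real (length xs))\<^sup>2) sums v"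
    by (rule centring_constants[OF q \<rho>(1,2) K]) (rule that)
  define V where "V xs = real (list_lis xs) - a * real (length xs)" for xs :: "nat list"
  define C where "C = 1 / (1 - q)"
  define b where "b t = char_numerator q a t" for t
  define d where "d t m = (\<Sum>xs\<in>indecomposables m. of_real (list_weight q xs) * (iexp (t * V xs) - 1))" for t m
  have w0: "0 \<le> list_weight q xs" for xs using list_weight_pos[OF q] by (simp add: less_imp_le)
  have Vb: "\<bar>V xs\<bar> \<le> real (length xs)" for xs
    unfolding V_def using a by (intro centred_lis_bound) auto
  have C: "0 \<le> C" "\<bar>q_pochhammer q n - \<phi>\<bar> \<le> C * \<rho> ^ n" for n
  proof -
    have "q ^ n / (1 - q) \<le> C * \<rho> ^ n"
      using power_mono[OF \<rho>(3), of n] q by (simp add: C_def divide_right_mono)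
    with \<phi>(4)[of n] show "\<bar>q_pochhammer q n - \<phi>\<bar> \<le> C * \<rho> ^ n" by linarith
  qed (use q in \<open>simp add: C_def\<close>)
  have low: "real m * indec_weight q m \<le> K * \<rho> ^ m" for m
  proof (cases "m = 0")
    case False
    then have "real m * indec_weight q m \<le> real m ^ 3 * indec_weight q m"
      using power_le_cube[of 1 m] indec_weight_nonneg[OF q] by (intro mult_right_mono) auto
    then show ?thesis using K[of m] by linarith
  qed (use \<rho> in simp)
  have geom: "(\<lambda>m. c * \<rho> ^ m) sums (c / (1 - \<rho>))" for c
    using sums_mult[OF geometric_sums[of \<rho>], of c] \<rho> by simp

  have b_alt: "b t n = (\<Sum>xs\<in>permutations_of_set {1..n}. of_real (list_weight q xs) * iexp (t * V xs))" for t n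
    unfolding b_def char_numerator_def V_def
    by (intro sum.cong refl) (simp add: length_finite_permutations_of_set)
  have b0: "b t 0 = 1" for t
    using list_lis_le_length[of "[]::nat list"] by (simp add: b_alt V_def list_weight_def)
  have b_bound: "cmod (b t n) \<le> 1" for t n
  proof -
    have "cmod (b t n) \<le> (\<Sum>xs\<in>permutations_of_set {1..n}. list_weight q xs)"
      unfolding b_alt by (rule order_trans[OF norm_sum]) (simp add: norm_mult w0)
    then show ?thesis using q_pochhammer_le_1[OF q, of n] by (simp add: sum_list_weight[unfolded One_nat_def])
  qed
  \<comment> \<open>\<open>V\<close> is additive over direct sums, as \<open>list_lis\<close> and
    \<open>length\<close> are, so the exponentials multiply.\<close>
  have b_ren: "b t n = (\<Sum>m=1..n. (of_real (indec_weight q m) + d t m) * b t (n - m))" if "0 < n" for t n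
  proof -
    have "of_real (indec_weight q m) + d t m = (\<Sum>xs\<in>indecomposables m. of_real (list_weight q xs) * iexp (t * V xs))" for m
      by (simp add: indec_weight_def d_def sum.distrib[symmetric] algebra_simps)
    moreover have "of_real (list_weight q (direct_sum xs ys)) * iexp (t * V (direct_sum xs ys)) =
      of_real (list_weight q xs) * iexp (t * V xs) * (of_real (list_weight q ys) * iexp (t * V ys))"
      if "xs \<in> permutations_of_set {1..m}" "ys \<in> permutations_of_set {1..k}" for m k xs ys
    proof -
      have "V (direct_sum xs ys) = V xs + V ys"
        by (simp add: V_def list_lis_direct_sum[OF that] length_direct_sum algebra_simps)
      then show ?thesis
        by (simp add: list_weight_direct_sum[OF that] distrib_left exp_add)
    qed
    ultimately show ?thesis
      unfolding b_alt by (simp only:) (rule sum_permutations_renewal[OF _ that])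
  qed
  \<comment> \<open>The factor \<open>\<bar>t\<bar>\<close> matters: at
    \<open>t = s / sqrt n\<close> it makes the error of \<open>renewal_perturbation\<close> of order
    1 / sqrt n.\<close>
  have d_bound: "cmod (d t m) \<le> \<bar>t\<bar> * K * \<rho> ^ m" for t m
  proof -
    have "cmod (d t m) \<le> (\<Sum>xs\<in>indecomposables m. \<bar>t\<bar> * (real m * list_weight q xs))"
      unfolding d_def
    proof (rule order_trans[OF norm_sum sum_mono])
      fix xs assume "xs \<in> indecomposables m"
      then have "\<bar>t * V xs\<bar> \<le> \<bar>t\<bar> * real m"
        using Vb[of xs] by (simp add: abs_mult mult_left_mono length_indecomposables)
      moreover have "cmod (iexp (t * V xs) - 1) \<le> \<bar>t * V xs\<bar>"
        using iexp_approx1[of "t * V xs" 0] by simp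
      ultimately have "cmod (iexp (t * V xs) - 1) \<le> \<bar>t\<bar> * real m" by linarith
      from mult_left_mono[OF this w0[of xs]]
      show "cmod (of_real (list_weight q xs) * (iexp (t * V xs) - 1)) \<le> \<bar>t\<bar> * (real m * list_weight q xs)"
        unfolding norm_mult norm_of_real using w0[of xs] by (simp add: mult_ac)
    qed
    also have "\<dots> = \<bar>t\<bar> * (real m * indec_weight q m)"
      by (simp add: sum_distrib_left indec_weight_def)
    also have "\<dots> \<le> \<bar>t\<bar> * (K * \<rho> ^ m)" by (intro mult_left_mono low) simp
    finally show ?thesis by simp
  qed
  have d_sum: "summable (d t)" for t
    by (rule summable_comparison_test'[OF sums_summable[OF geom], of 0]) (rule d_bound)
  \<comment> \<open>Second-order Taylor expansion of the exponential; the remainder is controlled by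
    the cube of the block size.\<close>
  have d_approx: "cmod (d t m - \<i> * t * indec_moment q V m + t\<^sup>2 / 2 * indec_moment q (\<lambda>xs. (V xs)\<^sup>2) m)
      \<le> \<bar>t\<bar> ^ 3 * K / 6 * \<rho> ^ m" for t m
  proof -
    let ?R = "\<lambda>x. iexp x - (\<Sum>k\<le>2. (\<i> * of_real x) ^ k / fact k)"
    have R: "?R x = iexp x - 1 - \<i> * x + x\<^sup>2 / 2" for x
    proof -
      have "\<i> * complex_of_real x * (\<i> * complex_of_real x) = - (of_real x * of_real x)"
        by (simp add: complex_eq_iff)
      then show ?thesis by (simp add: numeral_2_eq_2)
    qed
    have "d t m - \<i> * t * indec_moment q V m + t\<^sup>2 / 2 * indec_moment q (\<lambda>xs. (V xs)\<^sup>2) m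
      = (\<Sum>xs\<in>indecomposables m. of_real (list_weight q xs) * ?R (t * V xs))"
      unfolding R d_def indec_moment_def of_real_sum sum_distrib_left sum_subtractf[symmetric] sum.distrib[symmetric]
      by (intro sum.cong refl) (simp add: algebra_simps power_mult_distrib)
    also have "cmod \<dots> \<le> (\<Sum>xs\<in>indecomposables m. \<bar>t\<bar> ^ 3 / 6 * (real m ^ 3 * list_weight q xs))"
    proof (rule order_trans[OF norm_sum sum_mono])
      fix xs assume "xs \<in> indecomposables m"
      then have "\<bar>t * V xs\<bar> \<le> \<bar>t\<bar> * real m"
        using Vb[of xs] by (simp add: abs_mult mult_left_mono length_indecomposables)
      then have "\<bar>t * V xs\<bar> ^ 3 / 6 \<le> (\<bar>t\<bar> * real m) ^ 3 / 6" by (intro divide_right_mono power_mono) auto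
      moreover have "cmod (?R (t * V xs)) \<le> \<bar>t * V xs\<bar> ^ 3 / 6"
        using iexp_approx1[of "t * V xs" 2] by (simp add: eval_nat_numeral)
      ultimately have "cmod (?R (t * V xs)) \<le> \<bar>t\<bar> ^ 3 / 6 * real m ^ 3" by (simp add: power_mult_distrib)
      from mult_left_mono[OF this w0[of xs]]
      show "cmod (of_real (list_weight q xs) * ?R (t * V xs)) \<le> \<bar>t\<bar> ^ 3 / 6 * (real m ^ 3 * list_weight q xs)"
        unfolding norm_mult norm_of_real using w0[of xs] by (simp add: mult_ac)
    qed
    also have "\<dots> = \<bar>t\<bar> ^ 3 / 6 * (real m ^ 3 * indec_weight q m)"
      by (simp add: sum_distrib_left indec_weight_def)
    also have "\<dots> \<le> \<bar>t\<bar> ^ 3 / 6 * (K * \<rho> ^ m)" by (intro mult_left_mono K) simp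
    finally show ?thesis by simp
  qed
  \<comment> \<open>Summing over block sizes removes the linear term, because \<open>a\<close> was
    chosen to centre the score.\<close>
  have D_approx: "cmod (suminf (d t) + t\<^sup>2 / 2 * v) \<le> \<bar>t\<bar> ^ 3 * K / 6 / (1 - \<rho>)" for t
  proof -
    let ?e = "\<lambda>m. d t m - \<i> * t * indec_moment q V m + t\<^sup>2 / 2 * indec_moment q (\<lambda>xs. (V xs)\<^sup>2) m"
    have z: "(\<lambda>m. complex_of_real (indec_moment q V m)) sums of_real 0"
      using zero unfolding V_def[symmetric] by (rule sums_of_real)
    have v2: "(\<lambda>m. complex_of_real (t\<^sup>2 / 2 * indec_moment q (\<lambda>xs. (V xs)\<^sup>2) m)) sums of_real (t\<^sup>2 / 2 * v)"
      using sums_mult[OF var, of "t\<^sup>2 / 2"] unfolding V_def[symmetric] by (rule sums_of_real)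
    have e: "?e sums (suminf (d t) + t\<^sup>2 / 2 * v)"
      using sums_add[OF sums_diff[OF summable_sums[OF d_sum[of t]] sums_mult[OF z, of "\<i> * t"]] v2]
      by simp
    have ne: "summable (\<lambda>m. cmod (?e m))"
      by (rule summable_comparison_test'[OF sums_summable[OF geom], of 0]) (simp only: real_norm_def abs_norm_cancel, rule d_approx)
    have "cmod (suminf ?e) \<le> (\<Sum>m. cmod (?e m))" by (rule summable_norm[OF ne])
    also have "\<dots> \<le> (\<Sum>m. \<bar>t\<bar> ^ 3 * K / 6 * \<rho> ^ m)"
      by (intro suminf_le ne d_approx sums_summable[OF geom])
    also have "\<dots> = \<bar>t\<bar> ^ 3 * K / 6 / (1 - \<rho>)" by (rule sums_unique[OF geom, symmetric])
    finally show ?thesis using e by (simp add: sums_iff)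
  qed
  \<comment> \<open>Each term has real part a nonnegative weight times cos - 1.\<close>
  have D_re: "Re (suminf (d t)) \<le> 0" for t
  proof -
    have "(\<lambda>m. Re (d t m)) sums Re (suminf (d t))" by (intro sums_Re summable_sums d_sum)
    moreover have "Re (d t m) \<le> 0" for m
      unfolding d_def Re_sum by (intro sum_nonpos) (simp add: w0 mult_nonneg_nonpos Re_exp)
    ultimately show ?thesis by (rule sums_le[OF _ _ sums_zero, rotated]) 
  qed
  have lim: "(\<lambda>n. char_numerator q a (s / sqrt n) n / q_pochhammer q n) \<longlonglongrightarrow> complex_of_real (exp (- (\<phi> * v) * s\<^sup>2 / 2))" for s
  proof -
    let ?D = "\<lambda>n. suminf (d (s / sqrt (real n)))"
    \<comment> \<open>After multiplication by \<open>n\<close>, the quadratic term is constant in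
      \<open>n\<close> and the cubic error is O(1 / sqrt n).\<close>
    have nD: "(\<lambda>n. of_nat n * ?D n) \<longlonglongrightarrow> of_real (- s\<^sup>2 / 2 * v)"
    proof (rule Lim_transform)
      show "(\<lambda>n. complex_of_real (- s\<^sup>2 / 2 * v)) \<longlonglongrightarrow> of_real (- s\<^sup>2 / 2 * v)" by simp
      show "(\<lambda>n. of_nat n * ?D n - of_real (- s\<^sup>2 / 2 * v)) \<longlonglongrightarrow> 0"
      proof (rule Lim_null_comparison)
        show "eventually (\<lambda>n. cmod (of_nat n * ?D n - of_real (- s\<^sup>2 / 2 * v)) \<le> 
          \<bar>s\<bar> ^ 3 * K / 6 / (1 - \<rho>) / sqrt n) sequentially"
          using eventually_gt_at_top[of 0]
        proof eventually_elim
          case (elim n)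
          have sq: "(s / sqrt n)\<^sup>2 = s\<^sup>2 / n" by (simp add: power_divide)
          have "of_nat n * ?D n - of_real (- s\<^sup>2 / 2 * v) = of_nat n * (?D n + complex_of_real ((s / sqrt n)\<^sup>2 / 2 * v))"
            unfolding sq using elim by (simp add: distrib_left)
          then have "cmod (of_nat n * ?D n - of_real (- s\<^sup>2 / 2 * v)) = 
              n * cmod (?D n + complex_of_real ((s / sqrt n)\<^sup>2 / 2 * v))" by (simp add: norm_mult)
          also have "\<dots> \<le> n * (\<bar>s / sqrt n\<bar> ^ 3 * K / 6 / (1 - \<rho>))"
            using D_approx[of "s / sqrt n"] by (intro mult_left_mono) auto
          also have "\<dots> = \<bar>s\<bar> ^ 3 * K / 6 / (1 - \<rho>) * (n / sqrt n ^ 3)"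
            by (simp add: abs_divide power_divide algebra_simps)
          also have "n / sqrt n ^ 3 = 1 / sqrt n"
            using elim by (simp add: power3_eq_cube)
          finally show ?case by simp
        qed
        show "(\<lambda>n. \<bar>s\<bar> ^ 3 * K / 6 / (1 - \<rho>) / sqrt (real n)) \<longlonglongrightarrow> 0" by real_asymp
      qed
    qed
    have "(\<lambda>n. b (s / sqrt n) n) \<longlonglongrightarrow> of_real \<phi> * exp (of_real \<phi> * of_real (- s\<^sup>2 / 2 * v))"
    proof (rule linear_recursion_limit[where b = "\<lambda>n. b (s / sqrt n)"
          and M = "\<bar>s\<bar> * K * (C + \<phi>) / (1 - \<rho>)\<^sup>2", OF \<rho>(1,2) less_imp_le[OF \<phi>(1)] C(1) D_re nD])
      fix n k
      let ?t = "s / sqrt (real n)"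
      have "cmod (b ?t k - q_pochhammer q k - \<phi> * ?D n * (\<Sum>j\<le>k. b ?t j)) \<le> \<bar>?t\<bar> * K * (C + \<phi>) / (1 - \<rho>)\<^sup>2"
        by (rule renewal_perturbation[OF \<rho>(1,2) _ C(1) _ q_pochhammer_0 indec_weight_0 b0 _ q_pochhammer_renewal b_ren d_bound C(2) b_bound])
          (use \<phi> \<rho> in \<open>auto simp: d_def indecomposables_0\<close>)
      also have "\<dots> = \<bar>s\<bar> * K * (C + \<phi>) / (1 - \<rho>)\<^sup>2 / sqrt n" by simp
      finally have 1: "cmod (b ?t k - q_pochhammer q k - \<phi> * ?D n * (\<Sum>j\<le>k. b ?t j)) \<le> \<dots>" .
      \<comment> \<open>Replacing \<open>q_pochhammer q k\<close> by its limit accounts for the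
        geometric part of the error.\<close>
      have "b ?t k - (\<phi> + \<phi> * ?D n * (\<Sum>j\<le>k. b ?t j)) = of_real (q_pochhammer q k - \<phi>) 
        + (b ?t k - q_pochhammer q k - \<phi> * ?D n * (\<Sum>j\<le>k. b ?t j))" by simp
      also have "cmod \<dots> \<le> \<bar>q_pochhammer q k - \<phi>\<bar> + cmod (b ?t k - q_pochhammer q k - \<phi> * ?D n * (\<Sum>j\<le>k. b ?t j))"
        by (metis norm_triangle_ineq norm_of_real)
      finally show "cmod (b ?t k - (\<phi> + \<phi> * ?D n * (\<Sum>j\<le>k. b ?t j))) 
        \<le> C * \<rho> ^ k + \<bar>s\<bar> * K * (C + \<phi>) / (1 - \<rho>)\<^sup>2 / sqrt n"
        using 1 C(2)[of k] by linarith
    qed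
    \<comment> \<open>The prefactor \<phi> cancels against the limit of the normalisation.\<close>
    from tendsto_divide[OF this tendsto_of_real[OF \<phi>(3)]] \<phi>(1)
    have "(\<lambda>n. b (s / sqrt n) n / q_pochhammer q n) \<longlonglongrightarrow> exp (of_real \<phi> * of_real (- s\<^sup>2 / 2 * v))" by simp
    also have "exp (of_real \<phi> * of_real (- s\<^sup>2 / 2 * v)) = complex_of_real (exp (- (\<phi> * v) * s\<^sup>2 / 2))"
      by (simp add: exp_of_real[symmetric] mult_ac)
    finally show ?thesis by (simp add: b_def)
  qed
  show ?thesis by (rule that[OF a(1) mult_pos_pos[OF \<phi>(1) v] lim])
qed

section \<open>From convergence of characteristic functions to weak convergence\<close>

theorem theorem1:
  fixes q :: real
  assumes "0 < q" and "q < 1"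
  shows "\<exists>\<sigma> a :: real. \<sigma> > 0 \<and> a > 0 \<and>
    weak_conv_m
      (\<lambda>n. distr (mallows n q) borel
             (\<lambda>\<pi>. (real (lis_length n \<pi>) - a * real n) / (\<sigma> * sqrt (real n))))
      std_normal_distribution"
proof -
  obtain a v where a: "0 < a" and v: "0 < v"
    and lim: "\<And>s. (\<lambda>n. char_numerator q a (s / sqrt n) n / q_pochhammer q n) \<longlonglongrightarrow> complex_of_real (exp (- v * s\<^sup>2 / 2))"
    by (rule char_numerator_limit[OF assms]) (rule that)
  have "weak_conv_m (\<lambda>n. distr (mallows n q) borel
    (\<lambda>\<pi>. (real (lis_length n \<pi>) - a * real n) / (sqrt v * sqrt (real n)))) std_normal_distribution"
  proof (rule levy_continuity)
    show "real_distribution (distr (mallows n q) borel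
      (\<lambda>\<pi>. (real (lis_length n \<pi>) - a * real n) / (sqrt v * sqrt (real n))))" for n
      by (rule prob_space.real_distribution_distr[OF prob_space_measure_pmf]) simp
    show "real_distribution std_normal_distribution" by (rule real_dist_normal_dist)
    show "(\<lambda>n. char (distr (mallows n q) borel
      (\<lambda>\<pi>. (real (lis_length n \<pi>) - a * real n) / (sqrt v * sqrt (real n)))) t) \<longlonglongrightarrow> char std_normal_distribution t" for t
      \<comment> \<open>Evaluating at \<open>s = t / sqrt v\<close> cancels the variance and leaves
        the standard normal characteristic function.\<close>
      using lim[of "t / sqrt v"] v
      by (simp add: char_mallows[OF assms] char_std_normal_distribution power_divide)
  qed
  with a v show ?thesis by (intro exI[of _ "sqrt v"] exI[of _ a]) auto
qed

end
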